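(* Let $d=1$, $\Omega=(-1,1)$, let $K\subset\subset\Omega$ be a compact set, and let $0<\alpha<2$. Then there is a constant $C$, depending only on $\alpha$ and $K$ (and not on $\lambda$ or $e_\lambda$), such that for every $\lambda>1$ and every Dirichlet eigenfunction $e_\lambda$ of $(-\Delta)^{\alpha/2}$ on $\Omega$ with eigenvalue $\lambda$: $$\|e_\lambda\|_{L^\infty(K)}\le C\,\|e_\lambda\|_{L^2(\mathbb{R})}\quad\text{if } \tfrac14\le\alpha<2,$$ $$\|e_\lambda\|_{L^\infty(K)}\le C\,\lambda^{\frac1{2\alpha}-2}\,\|e_\lambda\|_{L^2(\mathbb{R})}\quad\text{if } \tfrac18\le\alpha<\tfrac14,$$ $$\|e_\lambda\|_{L^\infty(K)}\le C\,\lambda^{\frac1{3\alpha}-\frac23}\,\|e_\lambda\|_{L^2(\mathbb{R})}\quad\text{if } 0<\alpha<\tfrac18.$$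
   Context: For $0<\alpha<2$, $(-\Delta)^{\alpha/2}$ denotes the Fourier multiplier on $\mathbb{R}$ with symbol $|\xi|^\alpha$; pointwise, $(-\Delta)^{\alpha/2}u(x)=c_{1,\alpha}\,\mathrm{p.v.}\int_{\mathbb{R}}\frac{u(x)-u(y)}{|x-y|^{1+\alpha}}\,dy$ with $c_{1,\alpha}=\frac{2^\alpha\Gamma(\frac{1+\alpha}{2})}{\pi^{1/2}|\Gamma(-\frac{\alpha}{2})|}$. A Dirichlet eigenfunction of $(-\Delta)^{\alpha/2}$ on $\Omega$ with eigenvalue $\lambda$ (restricted fractional Laplacian) is a function $e_\lambda\in H^{\alpha/2}(\mathbb{R})$ with $(-\Delta)^{\alpha/2}e_\lambda=\lambda e_\lambda$ in $\Omega$ and $e_\lambda=0$ in $\mathbb{R}\setminus\Omega$. *)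

theory Defs
  imports "HOL-Probability.Essential_Supremum"
begin

text \<open>
  Elements of \<open>L\<^sup>2(\<real>)\<close> are represented by complex-valued Lebesgue measurable functions.
  The Fourier transform is normalised as the integral of \<open>exp (- i x \<xi>) u x\<close> over \<open>x\<close>; its
  inverse carries the factor \<open>1 / (2 \<pi>)\<close>.
\<close>

definition L2_fun :: "(real \<Rightarrow> complex) \<Rightarrow> bool" where
  "L2_fun u \<longleftrightarrow>
     u \<in> borel_measurable lebesgue \<and> integrable lebesgue (\<lambda>x. (cmod (u x))\<^sup>2)"

definition L2_norm_on_line :: "(real \<Rightarrow> complex) \<Rightarrow> real" where
  "L2_norm_on_line u = sqrt (LINT x|lebesgue. (cmod (u x))\<^sup>2)"

definition Linf_norm_on :: "real set \<Rightarrow> (real \<Rightarrow> complex) \<Rightarrow> ennreal" where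
  "Linf_norm_on K u = esssup (lebesgue_on K) (\<lambda>x. ennreal (cmod (u x)))"

text \<open>
  The Fourier--Plancherel transform: \<open>g\<close> is the transform of \<open>u\<close> if the transforms of the
  truncations of \<open>u\<close> to \<open>[-R, R]\<close> converge to \<open>g\<close> in \<open>L\<^sup>2\<close>. This determines \<open>g\<close> up to null sets.
\<close>

definition has_fourier_transform ::
    "(real \<Rightarrow> complex) \<Rightarrow> (real \<Rightarrow> complex) \<Rightarrow> bool" where
  "has_fourier_transform u g \<longleftrightarrow> L2_fun u \<and> L2_fun g \<and>
     ((\<lambda>R. \<integral>\<^sup>+ \<xi>. ennreal ((cmod (g \<xi> -
          (LINT x:{-R..R}|lebesgue. exp (- \<i> * complex_of_real (x * \<xi>)) * u x)))\<^sup>2) \<partial>lebesgue)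
        \<longlongrightarrow> 0) at_top"

definition sobolev_H :: "real \<Rightarrow> (real \<Rightarrow> complex) set" where
  "sobolev_H s = {u. \<exists>g. has_fourier_transform u g \<and>
     integrable lebesgue (\<lambda>\<xi>. (1 + \<xi>\<^sup>2) powr s * (cmod (g \<xi>))\<^sup>2)}"

text \<open>\<open>test_functions \<Omega>\<close> is \<open>C\<^sub>c\<^sup>\<infinity>(\<Omega>)\<close>; \<open>D k\<close> is the \<open>k\<close>-th derivative of \<open>\<phi>\<close>.\<close>

definition test_functions :: "real set \<Rightarrow> (real \<Rightarrow> complex) set" where
  "test_functions \<Omega> = {\<phi>.
     (\<exists>D :: nat \<Rightarrow> real \<Rightarrow> complex. D 0 = \<phi> \<and>
        (\<forall>k x. (D k has_vector_derivative D (Suc k) x) (at x))) \<and>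
     (\<exists>S. compact S \<and> S \<subseteq> \<Omega> \<and> (\<forall>x. x \<notin> S \<longrightarrow> \<phi> x = 0))}"

definition inv_fourier :: "(real \<Rightarrow> complex) \<Rightarrow> real \<Rightarrow> complex" where
  "inv_fourier \<phi> \<xi> =
     (LINT x|lebesgue. exp (\<i> * complex_of_real (x * \<xi>)) * \<phi> x) / complex_of_real (2 * pi)"

text \<open>
  \<open>(- \<Delta>)\<^bsup>\<alpha>/2\<^esup> u = f\<close> in \<open>\<Omega>\<close>, in the sense of distributions, where \<open>(- \<Delta>)\<^bsup>\<alpha>/2\<^esup> u\<close> is the
  tempered distribution given by the inverse Fourier transform of \<open>\<bar>\<xi>\<bar>\<^sup>\<alpha> g \<xi>\<close>, with \<open>g\<close> the
  Fourier transform of \<open>u\<close>: its (bilinear) pairing with \<open>\<phi>\<close> is the pairing of \<open>\<bar>\<xi>\<bar>\<^sup>\<alpha> g \<xi>\<close> with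
  the inverse Fourier transform of \<open>\<phi>\<close>.
\<close>

definition frac_laplacian_eq_on ::
    "real set \<Rightarrow> real \<Rightarrow> (real \<Rightarrow> complex) \<Rightarrow> (real \<Rightarrow> complex) \<Rightarrow> bool" where
  "frac_laplacian_eq_on \<Omega> \<alpha> u f \<longleftrightarrow>
     (\<exists>g. has_fourier_transform u g \<and>
       (\<forall>\<phi>\<in>test_functions \<Omega>.
          (LINT \<xi>|lebesgue. complex_of_real (\<bar>\<xi>\<bar> powr \<alpha>) * g \<xi> * inv_fourier \<phi> \<xi>) =
          (LINT x|lebesgue. f x * \<phi> x)))"

definition dirichlet_eigenfunction ::
    "real \<Rightarrow> real set \<Rightarrow> real \<Rightarrow> (real \<Rightarrow> complex) \<Rightarrow> bool" where
  "dirichlet_eigenfunction \<alpha> \<Omega> lam e \<longleftrightarrow>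
     e \<in> sobolev_H (\<alpha> / 2) \<and>
     frac_laplacian_eq_on \<Omega> \<alpha> e (\<lambda>x. complex_of_real lam * e x) \<and>
     (AE x in lebesgue. x \<notin> \<Omega> \<longrightarrow> e x = 0)"

end

theory Submission
  imports Defs "HOL-Probability.Characteristic_Functions" "HOL-Probability.Sinc_Integral"
begin

text \<open>
  The bound holds in the uniform form \<open>\<parallel>e\<parallel> \<le> C \<parallel>e\<parallel>\<^sub>2\<close> on \<open>K\<close> for every \<open>\<alpha>\<close> in \<open>(0, 2)\<close>
  (lemma \<open>eigenfunction_interior_bound\<close>). The two remaining cases follow from it, since \<open>lam > 1\<close>
  and the exponents \<open>1 / (2 \<alpha>) - 2\<close> and \<open>1 / (3 \<alpha>) - 2 / 3\<close> are nonnegative in their ranges.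

  The uniform bound is a one-dimensional resolvent estimate for a localised eigenfunction. Let
  \<open>\<chi>\<close> be a smooth cutoff that is positive on \<open>K\<close> and supported in \<open>(-1, 1)\<close>, and let
  \<open>w = \<chi> e\<close> and \<open>lam = \<mu> powr \<alpha>\<close>. Testing the equation with \<open>\<chi> x * exp (- i x \<eta>)\<close> shows that
  \<open>(\<bar>\<eta>\<bar> powr \<alpha> - \<mu> powr \<alpha>) * w^ \<eta>\<close>, where \<open>^\<close> is the Fourier transform, equals the transform of
  the commutator of the fractional Laplacian with \<open>\<chi>\<close>, applied to \<open>e\<close>, namely \<open>1 / (2 \<pi>)\<close> times
  the integral of \<open>(\<bar>\<eta>\<bar> powr \<alpha> - \<bar>\<xi>\<bar> powr \<alpha>) * \<chi>^ (\<eta> - \<xi>) * e^ \<xi>\<close> over \<open>\<xi>\<close>.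

  The commutator has order \<open>\<alpha> - 1\<close>: by \<open>abs_powr_diff_le\<close> and the rapid decay of \<open>\<chi>^\<close>, it is
  bounded by \<open>(1 + \<bar>\<eta>\<bar>) powr (\<alpha> - 1) * H \<eta>\<close>, where \<open>H\<close> is a convolution of \<open>\<bar>e^\<bar>\<close> with an
  integrable kernel, hence square integrable with norm \<open>O(\<parallel>e\<parallel>\<^sub>2)\<close> (lemmas
  \<open>cutoff_fourier_estimate\<close>, \<open>lorentz_convolution_L2\<close>, \<open>plancherel_le\<close>). The same power appears
  when one divides by the symbol (\<open>inverse_symbol_bound\<close>), so it cancels and leaves
  \<open>\<bar>w^ \<eta>\<bar> \<le> C H \<eta> (1 / \<bar>\<bar>\<eta>\<bar> - \<mu>\<bar> + 1 / (1 + \<bar>\<eta>\<bar>))\<close>. The last factor is square integrable over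
  \<open>\<bar>\<bar>\<eta>\<bar> - \<mu>\<bar> \<ge> 1\<close> uniformly in \<open>\<mu>\<close>, and the resonant set \<open>\<bar>\<bar>\<eta>\<bar> - \<mu>\<bar> < 1\<close> has measure at
  most \<open>4\<close> with \<open>\<bar>w^\<bar> \<le> C \<parallel>e\<parallel>\<^sub>2\<close> on it. Hence \<open>w^\<close> is integrable with norm \<open>O(\<parallel>e\<parallel>\<^sub>2)\<close>
  (\<open>cutoff_sup_bound\<close>), and Fourier inversion, in the form of \<open>AE_cmod_le_fourier\<close>, bounds \<open>w\<close>.

  The eigenfunction vanishes outside a bounded interval, so its Plancherel transform is the absolutely
  convergent Fourier integral and only that integral is used below; Parseval's formula and the
  Plancherel inequality are obtained by Gaussian regularisation.
\<close>

section \<open>The Fourier integral and its Gaussian regularisation\<close>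

definition fourier :: "(real \<Rightarrow> complex) \<Rightarrow> real \<Rightarrow> complex" where
  "fourier f \<xi> = (LINT x|lborel. cis (- (x * \<xi>)) * f x)"

lemma borel_measurable_cis [measurable]: "cis \<in> borel_measurable borel"
  by (intro borel_measurable_continuous_onI continuous_intros)

lemma integrable_cis_mult:
  assumes "integrable lborel f" and [measurable]: "t \<in> borel_measurable borel"
  shows "integrable lborel (\<lambda>x::real. cis (t x) * f x)"
proof -
  have [measurable]: "f \<in> borel_measurable borel"
    using borel_measurable_integrable[OF assms(1)] by simp
  show ?thesis
    by (rule Bochner_Integration.integrable_bound[OF assms(1)]) (auto simp: norm_mult)
qed

lemma borel_measurable_fourier [measurable]:
  assumes [measurable]: "f \<in> borel_measurable borel"
  shows "fourier f \<in> borel_measurable borel"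
  unfolding fourier_def by measurable

lemma norm_fourier_le: "cmod (fourier f \<xi>) \<le> (LINT x|lborel. cmod (f x))"
proof -
  have "cmod (fourier f \<xi>) \<le> (LINT x|lborel. cmod (cis (- (x * \<xi>)) * f x))"
    unfolding fourier_def by (rule integral_norm_bound)
  then show ?thesis by (simp add: norm_mult)
qed

text \<open>
  Fubini, applied to the symmetric kernel \<open>cis (- (x * y))\<close>.
\<close>
lemma multiplication_formula:
  assumes a: "integrable lborel a" and b: "integrable lborel b"
  shows "(LINT x|lborel. a x * fourier b x) = (LINT y|lborel. fourier a y * b y)"
proof -
  have [measurable]: "a \<in> borel_measurable borel" "b \<in> borel_measurable borel"
    using borel_measurable_integrable[OF a] borel_measurable_integrable[OF b] by simp_all
  let ?F = "\<lambda>x y. a x * (cis (- (y * x)) * b y)"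
  have "integrable (lborel \<Otimes>\<^sub>M lborel) (\<lambda>(x, y). ?F x y)"
  proof (rule lborel_pair.Fubini_integrable)
    show "integrable lborel (\<lambda>x. LINT y|lborel. cmod (case (x, y) of (x, y) \<Rightarrow> ?F x y))"
      using integrable_norm[OF a] by (simp add: norm_mult)
    show "AE x in lborel. integrable lborel (\<lambda>y. case (x, y) of (x, y) \<Rightarrow> ?F x y)"
      using integrable_cis_mult[OF b] by simp
  qed measurable
  from lborel_pair.Fubini_integral[OF this]
  have "(LINT x|lborel. LINT y|lborel. ?F x y) = (LINT y|lborel. LINT x|lborel. ?F x y)" ..
  also have "\<dots> = (LINT y|lborel. fourier a y * b y)"
    unfolding fourier_def integral_mult_left_zero[symmetric]
    by (intro Bochner_Integration.integral_cong refl) (simp add: mult_ac)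
  finally show ?thesis by (simp add: fourier_def)
qed

text \<open>
  The centred normal density with standard deviation \<open>1 / (n + 1)\<close>: an approximate identity. Its
  Fourier multiplier is the Gaussian weight \<open>gauss n\<close>, which makes all integrals below converge and
  tends to \<open>1\<close>.
\<close>
definition heat_kernel :: "nat \<Rightarrow> real \<Rightarrow> real" where
  "heat_kernel n z = real (Suc n) * std_normal_density (real (Suc n) * z)"

definition gauss :: "nat \<Rightarrow> real \<Rightarrow> complex" where
  "gauss n \<xi> = complex_of_real (exp (- (\<xi> / real (Suc n))\<^sup>2 / 2))"

lemma gauss_measurable [measurable]: "gauss n \<in> borel_measurable borel"
  unfolding gauss_def by measurable

lemma integrable_gauss: "integrable lborel (gauss n)"
proof -
  have "integrable lborel (\<lambda>x. sqrt (2 * pi) * std_normal_density (0 + (1 / real (Suc n)) * x))"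
    by (intro integrable_mult_right lborel_integrable_real_affine) auto
  then have "integrable lborel (\<lambda>x. complex_of_real (sqrt (2 * pi) * std_normal_density (0 + (1 / real (Suc n)) * x)))"
    by (rule integrable_of_real)
  then show ?thesis
    by (simp add: gauss_def[abs_def] std_normal_density_def power_divide)
qed

lemma heat_kernel_measurable [measurable]: "heat_kernel n \<in> borel_measurable borel"
  unfolding heat_kernel_def by measurable

lemma heat_kernel_nonneg: "0 \<le> heat_kernel n z"
  by (simp add: heat_kernel_def)

lemma std_normal_transform:
  "(LINT x|lborel. cis (z * x) * complex_of_real (std_normal_density x)) = complex_of_real (exp (- z\<^sup>2 / 2))"
proof -
  have "char std_normal_distribution z = (CLINT x|lborel. std_normal_density x *\<^sub>R iexp (z * x))"
    unfolding char_def by (rule integral_density) auto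
  then show ?thesis
    by (simp add: char_std_normal_distribution cis_conv_exp scaleR_conv_of_real mult.commute)
qed

lemma gauss_transform:
  "(LINT \<xi>|lborel. cis (z * \<xi>) * gauss n \<xi>) = complex_of_real (2 * pi * heat_kernel n z)"
proof -
  let ?N = "real (Suc n)"
  have "(LINT \<xi>|lborel. cis (z * \<xi>) * gauss n \<xi>)
     = ?N *\<^sub>R (LINT \<xi>|lborel. cis (z * (0 + ?N * \<xi>)) * gauss n (0 + ?N * \<xi>))"
    using lborel_integral_real_affine[of ?N "\<lambda>\<xi>. cis (z * \<xi>) * gauss n \<xi>" 0] by simp
  also have "(\<lambda>\<xi>. cis (z * (0 + ?N * \<xi>)) * gauss n (0 + ?N * \<xi>))
     = (\<lambda>\<xi>. complex_of_real (sqrt (2 * pi)) * (cis ((?N * z) * \<xi>) * complex_of_real (std_normal_density \<xi>)))"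
    by (simp add: fun_eq_iff gauss_def std_normal_density_def mult_ac del: of_nat_Suc)
  also have "(LINT \<xi>|lborel. complex_of_real (sqrt (2 * pi)) * (cis ((?N * z) * \<xi>) * complex_of_real (std_normal_density \<xi>)))
     = complex_of_real (sqrt (2 * pi)) * complex_of_real (exp (- (?N * z)\<^sup>2 / 2))"
    by (subst integral_mult_right_zero) (subst std_normal_transform, simp)
  finally have *: "(LINT \<xi>|lborel. cis (z * \<xi>) * gauss n \<xi>)
     = complex_of_real (?N * (sqrt (2 * pi) * exp (- (?N * z)\<^sup>2 / 2)))"
    by (simp add: scaleR_conv_of_real)
  have "2 * pi * heat_kernel n z = ?N * ((2 * pi) / sqrt (2 * pi) * exp (- (?N * z)\<^sup>2 / 2))"
    unfolding heat_kernel_def std_normal_density_def by (simp add: mult_ac)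
  also have "(2 * pi) / sqrt (2 * pi) = sqrt (2 * pi)"
    by (rule real_div_sqrt) simp
  finally show ?thesis using * by simp
qed

lemma integrable_heat_kernel: "integrable lborel (\<lambda>x. heat_kernel n (x - y))"
  and integral_heat_kernel: "(LINT x|lborel. heat_kernel n (x - y)) = 1"
proof -
  define N where "N = real (Suc n)"
  have N: "N > 0" by (simp add: N_def)
  have "has_bochner_integral lborel std_normal_density 1"
    by (simp add: has_bochner_integral_iff)
  then have "has_bochner_integral lborel (\<lambda>x. std_normal_density (- (N * y) + N * x)) (1 /\<^sub>R \<bar>N\<bar>)"
    using lborel_has_bochner_integral_real_affine_iff[of N std_normal_density 1 "- (N * y)"] N by simp
  then have "has_bochner_integral lborel (\<lambda>x. N * std_normal_density (- (N * y) + N * x)) (N * (1 /\<^sub>R \<bar>N\<bar>))"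
    by (rule has_bochner_integral_mult_right)
  moreover have "N * std_normal_density (- (N * y) + N * x) = heat_kernel n (x - y)" for x
    by (simp add: heat_kernel_def N_def algebra_simps)
  ultimately have "has_bochner_integral lborel (\<lambda>x. heat_kernel n (x - y)) 1"
    using N by simp
  then show "integrable lborel (\<lambda>x. heat_kernel n (x - y))" "(LINT x|lborel. heat_kernel n (x - y)) = 1"
    by (simp_all add: has_bochner_integral_iff)
qed

lemma heat_kernel_sym: "heat_kernel n (x - y) = heat_kernel n (y - x)"
proof -
  have "real (Suc n) * (x - y) = - (real (Suc n) * (y - x))" by (simp add: algebra_simps)
  then show ?thesis by (simp add: heat_kernel_def std_normal_density_def del: of_nat_Suc)
qed

text \<open>
  The regularised Parseval formula: inserting the Gaussian weight on the frequency side amounts to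
  smearing the pairing of \<open>h\<close> and \<open>f\<close> with the heat kernel. Both transforms are moved off by the
  multiplication formula, and the last one hits the Gaussian.
\<close>
lemma fourier_gauss_pairing:
  fixes h f :: "real \<Rightarrow> complex"
  assumes h: "integrable lborel h" and f: "integrable lborel f"
  shows "(LINT \<xi>|lborel. fourier h (- \<xi>) * fourier f \<xi> * gauss n \<xi>) =
    2 * pi * (LINT y|lborel. f y * (LINT x|lborel. h x * heat_kernel n (x - y)))"
proof -
  have [measurable]: "h \<in> borel_measurable borel" "f \<in> borel_measurable borel"
    using borel_measurable_integrable[OF h] borel_measurable_integrable[OF f] by simp_all
  let ?a = "\<lambda>\<xi>. fourier h (- \<xi>) * gauss n \<xi>"
  have a: "integrable lborel ?a"
  proof (rule Bochner_Integration.integrable_bound)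
    show "integrable lborel (\<lambda>\<xi>. (LINT x|lborel. cmod (h x)) * gauss n \<xi>)"
      using integrable_gauss by simp
    show "AE \<xi> in lborel. cmod (?a \<xi>) \<le> cmod ((LINT x|lborel. cmod (h x)) * gauss n \<xi>)"
    proof (rule AE_I2)
      fix \<xi>
      have "cmod (fourier h (- \<xi>)) \<le> \<bar>LINT x|lborel. cmod (h x)\<bar>"
        using norm_fourier_le[of h "- \<xi>"] by linarith
      then show "cmod (?a \<xi>) \<le> cmod ((LINT x|lborel. cmod (h x)) * gauss n \<xi>)"
        by (simp add: norm_mult mult_right_mono)
    qed
  qed measurable
  have "(LINT \<xi>|lborel. fourier h (- \<xi>) * fourier f \<xi> * gauss n \<xi>) = (LINT \<xi>|lborel. ?a \<xi> * fourier f \<xi>)"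
    by (simp add: mult_ac)
  also have "\<dots> = (LINT y|lborel. fourier ?a y * f y)"
    by (rule multiplication_formula[OF a f])
  also have "\<dots> = (LINT y|lborel. 2 * pi * (f y * (LINT x|lborel. h x * heat_kernel n (x - y))))"
  proof (rule Bochner_Integration.integral_cong[OF refl])
    fix y
    let ?b = "\<lambda>\<xi>. cis (y * \<xi>) * gauss n \<xi>"
    have b: "integrable lborel ?b"
      by (rule integrable_cis_mult[OF integrable_gauss]) measurable
    have "fourier ?a y = (LINT \<xi>|lborel. fourier h \<xi> * ?b \<xi>)"
      unfolding fourier_def[of ?a]
      by (subst lborel_integral_real_affine[where c = "-1" and t = 0])
         (simp_all add: mult_ac gauss_def)
    also have "\<dots> = (LINT x|lborel. h x * fourier ?b x)"
      by (rule multiplication_formula[OF h b, symmetric])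
    also have "\<dots> = (LINT x|lborel. (2 * pi) * (h x * heat_kernel n (x - y)))"
    proof (rule Bochner_Integration.integral_cong[OF refl])
      fix x
      have "fourier ?b x = (LINT \<xi>|lborel. cis ((y - x) * \<xi>) * gauss n \<xi>)"
        unfolding fourier_def
        by (intro Bochner_Integration.integral_cong refl)
           (simp add: mult.assoc[symmetric] cis_mult, simp add: algebra_simps)
      then show "h x * fourier ?b x = (2 * pi) * (h x * heat_kernel n (x - y))"
        using heat_kernel_sym[of n x y] by (simp add: gauss_transform)
    qed
    also have "\<dots> = 2 * pi * (LINT x|lborel. h x * heat_kernel n (x - y))"
      by (subst integral_mult_right_zero) simp
    finally show "fourier ?a y * f y = 2 * pi * (f y * (LINT x|lborel. h x * heat_kernel n (x - y)))"
      by (simp add: mult_ac)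
  qed
  also have "\<dots> = 2 * pi * (LINT y|lborel. f y * (LINT x|lborel. h x * heat_kernel n (x - y)))"
    by (subst integral_mult_right_zero) simp
  finally show ?thesis .
qed

section \<open>Parseval's formula and the Plancherel inequality\<close>

text \<open>
  Rescaling turns the average into the integral of \<open>h (y + t / (n + 1))\<close> against the standard normal
  density, to which dominated convergence applies.
\<close>
lemma heat_kernel_average:
  fixes h :: "real \<Rightarrow> complex"
  assumes h: "continuous_on UNIV h" and B: "\<And>x. cmod (h x) \<le> B"
  shows "cmod (LINT x|lborel. h x * heat_kernel n (x - y)) \<le> B"
    and "(\<lambda>n. LINT x|lborel. h x * heat_kernel n (x - y)) \<longlonglongrightarrow> h y"
proof -
  have [measurable]: "h \<in> borel_measurable borel"
    using h by (rule borel_measurable_continuous_onI)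
  have std: "integrable lborel std_normal_density" "(LINT t|lborel. std_normal_density t) = 1"
    by simp_all
  have eq: "(LINT x|lborel. h x * heat_kernel n (x - y))
      = (LINT t|lborel. h (y + t / real (Suc n)) * std_normal_density t)" for n
    by (subst lborel_integral_real_affine[where c = "1 / real (Suc n)" and t = y])
       (simp_all add: heat_kernel_def scaleR_conv_of_real integral_mult_right_zero[symmetric]
          mult_ac del: of_nat_Suc integral_mult_right_zero integral_mult_right)
  have bnd: "cmod (h (y + t / real (Suc n)) * std_normal_density t) \<le> B * std_normal_density t" for n t
    using B by (simp add: norm_mult mult_right_mono)
  have Bint: "integrable lborel (\<lambda>t. B * std_normal_density t)"
    using std by simp
  show "cmod (LINT x|lborel. h x * heat_kernel n (x - y)) \<le> B"
  proof -
    have "cmod (LINT x|lborel. h x * heat_kernel n (x - y)) \<le> (LINT t|lborel. B * std_normal_density t)"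
      unfolding eq by (rule Bochner_Integration.integral_norm_bound_integral[OF _ Bint bnd])
         (rule Bochner_Integration.integrable_bound[OF Bint], simp,
          intro AE_I2 order_trans[OF bnd], simp)
    also have "\<dots> = B" using std by simp
    finally show ?thesis .
  qed
  have "(\<lambda>n. LINT t|lborel. h (y + t / real (Suc n)) * std_normal_density t)
      \<longlonglongrightarrow> (LINT t|lborel. h y * std_normal_density t)"
  proof (rule integral_dominated_convergence[OF _ _ Bint])
    show "AE t in lborel. (\<lambda>n. h (y + t / real (Suc n)) * std_normal_density t) \<longlonglongrightarrow> h y * std_normal_density t"
    proof (rule AE_I2)
      fix t
      have "(\<lambda>n. y + t / real (Suc n)) \<longlonglongrightarrow> y + 0"
        by (intro tendsto_intros LIMSEQ_Suc lim_const_over_n)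
      moreover have "isCont h y" using h by (simp add: continuous_on_eq_continuous_at)
      ultimately have "(\<lambda>n. h (y + t / real (Suc n))) \<longlonglongrightarrow> h y"
        by (intro isCont_tendsto_compose[of y h]) auto
      then show "(\<lambda>n. h (y + t / real (Suc n)) * std_normal_density t) \<longlonglongrightarrow> h y * std_normal_density t"
        by (intro tendsto_intros)
    qed
    show "AE t in lborel. cmod (h (y + t / real (Suc n)) * std_normal_density t) \<le> B * std_normal_density t" for n
      using bnd by (intro AE_I2)
  qed measurable
  then show "(\<lambda>n. LINT x|lborel. h x * heat_kernel n (x - y)) \<longlonglongrightarrow> h y"
    unfolding eq using std by simp
qed

lemma gauss_tendsto: "(\<lambda>n. exp (- (\<xi> / real (Suc n))\<^sup>2 / 2)) \<longlonglongrightarrow> 1"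
proof -
  have "(\<lambda>n. \<xi> / real (Suc n)) \<longlonglongrightarrow> 0"
    using LIMSEQ_Suc[OF lim_const_over_n[of \<xi>]] by simp
  then have "(\<lambda>n. exp (- (\<xi> / real (Suc n))\<^sup>2 / 2)) \<longlonglongrightarrow> exp (- 0\<^sup>2 / 2)"
    by (intro tendsto_intros) auto
  then show ?thesis by simp
qed

text \<open>
  The limit of \<open>fourier_gauss_pairing\<close>. The product of the transforms is integrable
  by the decay of the first factor when \<open>h\<close> is smooth, and by that of the second one in the proof of
  Fourier inversion.
\<close>
lemma parseval:
  fixes h f :: "real \<Rightarrow> complex"
  assumes h: "integrable lborel h" "continuous_on UNIV h" and B: "\<And>x. cmod (h x) \<le> B"
    and f: "integrable lborel f" and int: "integrable lborel (\<lambda>\<xi>. fourier h (- \<xi>) * fourier f \<xi>)"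
  shows "(LINT \<xi>|lborel. fourier h (- \<xi>) * fourier f \<xi>) = 2 * pi * (LINT x|lborel. h x * f x)"
proof -
  have [measurable]: "h \<in> borel_measurable borel" "f \<in> borel_measurable borel"
    using borel_measurable_integrable[OF h(1)] borel_measurable_integrable[OF f] by simp_all
  have "(\<lambda>n. LINT \<xi>|lborel. fourier h (- \<xi>) * fourier f \<xi> * gauss n \<xi>)
      \<longlonglongrightarrow> (LINT \<xi>|lborel. fourier h (- \<xi>) * fourier f \<xi>)"
  proof (rule integral_dominated_convergence[OF _ _ integrable_norm[OF int]])
    show "AE \<xi> in lborel. (\<lambda>n. fourier h (- \<xi>) * fourier f \<xi> * gauss n \<xi>) \<longlonglongrightarrow> fourier h (- \<xi>) * fourier f \<xi>"
    proof (rule AE_I2)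
      fix \<xi>
      have "(\<lambda>n. gauss n \<xi>) \<longlonglongrightarrow> complex_of_real 1"
        unfolding gauss_def by (intro tendsto_of_real gauss_tendsto)
      then have "(\<lambda>n. fourier h (- \<xi>) * fourier f \<xi> * gauss n \<xi>) \<longlonglongrightarrow> fourier h (- \<xi>) * fourier f \<xi> * complex_of_real 1"
        by (intro tendsto_intros)
      then show "(\<lambda>n. fourier h (- \<xi>) * fourier f \<xi> * gauss n \<xi>) \<longlonglongrightarrow> fourier h (- \<xi>) * fourier f \<xi>"
        by simp
    qed
    show "AE \<xi> in lborel. cmod (fourier h (- \<xi>) * fourier f \<xi> * gauss n \<xi>) \<le> cmod (fourier h (- \<xi>) * fourier f \<xi>)" for n
      by (intro AE_I2) (auto simp: norm_mult gauss_def intro!: mult_left_le)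
  qed measurable
  moreover have "(\<lambda>n. LINT \<xi>|lborel. fourier h (- \<xi>) * fourier f \<xi> * gauss n \<xi>)
      \<longlonglongrightarrow> 2 * pi * (LINT y|lborel. f y * h y)"
    unfolding fourier_gauss_pairing[OF h(1) f]
  proof (intro tendsto_intros integral_dominated_convergence)
    show "integrable lborel (\<lambda>y. B * cmod (f y))"
      using f by (simp add: integrable_norm)
    show "AE y in lborel. (\<lambda>n. f y * (LINT x|lborel. h x * heat_kernel n (x - y))) \<longlonglongrightarrow> f y * h y"
      using heat_kernel_average(2)[OF h(2) B] by (intro AE_I2 tendsto_intros)
    show "AE y in lborel. cmod (f y * (LINT x|lborel. h x * heat_kernel n (x - y))) \<le> B * cmod (f y)" for n
      using heat_kernel_average(1)[OF h(2) B]
      by (intro AE_I2) (auto simp: norm_mult mult.commute[of B] intro!: mult_left_mono)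
  qed measurable
  ultimately show ?thesis
    by (simp add: LIMSEQ_unique mult.commute)
qed

lemma norm_integral_le_nn_integral:
  fixes f :: "'a \<Rightarrow> 'b::{banach, second_countable_topology}"
  shows "ennreal (norm (integral\<^sup>L M f)) \<le> (\<integral>\<^sup>+x. ennreal (norm (f x)) \<partial>M)"
  by (cases "integrable M f") (auto simp: integral_norm_bound_ennreal not_integrable_integral_eq)

text \<open>
  Schur's test: \<open>2 \<bar>f x\<bar> \<bar>f y\<bar> \<le> \<bar>f x\<bar>\<^sup>2 + \<bar>f y\<bar>\<^sup>2\<close>, and the kernel has mass \<open>1\<close> in each variable.
\<close>
lemma heat_kernel_schur:
  fixes f :: "real \<Rightarrow> complex"
  assumes [measurable]: "f \<in> borel_measurable borel"
  shows "(\<integral>\<^sup>+y. ennreal (cmod (f y)) * (\<integral>\<^sup>+x. ennreal (cmod (f x) * heat_kernel n (x - y)) \<partial>lborel) \<partial>lborel)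
    \<le> (\<integral>\<^sup>+x. ennreal ((cmod (f x))\<^sup>2) \<partial>lborel)" (is "_ \<le> ?N")
proof -
  let ?k = "\<lambda>x y. ennreal (heat_kernel n (x - y))"
  have k1: "(\<integral>\<^sup>+x. ?k x y \<partial>lborel) = 1" for y
    using integral_heat_kernel[of n y]
    by (subst nn_integral_eq_integral[OF integrable_heat_kernel]) (simp_all add: heat_kernel_nonneg)
  have k2: "(\<integral>\<^sup>+y. ?k x y \<partial>lborel) = 1" for x
    using k1[of x] by (simp add: heat_kernel_sym[of n x])
  let ?u = "\<lambda>x. ennreal ((cmod (f x))\<^sup>2)"
  have *: "ennreal (cmod (f y)) * ennreal (cmod (f x) * heat_kernel n (x - y)) \<le> ennreal (1/2) * (?u y * ?k x y) + ennreal (1/2) * (?u x * ?k x y)" for x y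
  proof -
    have "cmod (f y) * cmod (f x) \<le> (1/2) * (cmod (f y))\<^sup>2 + (1/2) * (cmod (f x))\<^sup>2"
      using sum_squares_bound[of "cmod (f y)" "cmod (f x)"] by simp
    from mult_right_mono[OF this heat_kernel_nonneg[of n "x - y"]]
    have "cmod (f y) * (cmod (f x) * heat_kernel n (x - y)) \<le> (1/2) * ((cmod (f y))\<^sup>2 * heat_kernel n (x - y)) + (1/2) * ((cmod (f x))\<^sup>2 * heat_kernel n (x - y))"
      by (simp add: algebra_simps)
    then have "ennreal (cmod (f y) * (cmod (f x) * heat_kernel n (x - y))) \<le> ennreal ((1/2) * ((cmod (f y))\<^sup>2 * heat_kernel n (x - y)) + (1/2) * ((cmod (f x))\<^sup>2 * heat_kernel n (x - y)))"
      by (rule ennreal_leI)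
    then show ?thesis
      by (simp add: ennreal_mult'[symmetric] ennreal_plus[symmetric] heat_kernel_nonneg del: ennreal_half ennreal_plus)
  qed
  have "(\<integral>\<^sup>+y. ennreal (cmod (f y)) * (\<integral>\<^sup>+x. ennreal (cmod (f x) * heat_kernel n (x - y)) \<partial>lborel) \<partial>lborel)
     = (\<integral>\<^sup>+y. \<integral>\<^sup>+x. ennreal (cmod (f y)) * ennreal (cmod (f x) * heat_kernel n (x - y)) \<partial>lborel \<partial>lborel)"
    by (subst nn_integral_cmult) auto
  also have "\<dots> \<le> (\<integral>\<^sup>+y. \<integral>\<^sup>+x. ennreal (1/2) * (?u y * ?k x y) + ennreal (1/2) * (?u x * ?k x y) \<partial>lborel \<partial>lborel)"
    by (intro nn_integral_mono *)
  also have "\<dots> = ennreal (1/2) * (\<integral>\<^sup>+y. \<integral>\<^sup>+x. ?u y * ?k x y \<partial>lborel \<partial>lborel) + ennreal (1/2) * (\<integral>\<^sup>+y. \<integral>\<^sup>+x. ?u x * ?k x y \<partial>lborel \<partial>lborel)"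
    by (simp add: nn_integral_add nn_integral_cmult del: ennreal_half)
  also have "(\<integral>\<^sup>+y. \<integral>\<^sup>+x. ?u x * ?k x y \<partial>lborel \<partial>lborel) = (\<integral>\<^sup>+x. \<integral>\<^sup>+y. ?u x * ?k x y \<partial>lborel \<partial>lborel)"
    by (rule lborel_pair.Fubini') measurable
  also have "\<dots> = ?N"
    by (simp add: nn_integral_cmult k2)
  also have "(\<integral>\<^sup>+y. \<integral>\<^sup>+x. ?u y * ?k x y \<partial>lborel \<partial>lborel) = ?N"
    by (simp add: nn_integral_cmult k1)
  also have "ennreal (1/2) * ?N + ennreal (1/2) * ?N = ?N"
    by (simp add: distrib_right[symmetric] ennreal_plus[symmetric] del: ennreal_plus ennreal_half)
  finally show ?thesis .
qed

lemma fourier_cnj: "fourier (\<lambda>x. cnj (f x)) (- \<xi>) = cnj (fourier f \<xi>)"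
proof -
  have "cnj (fourier f \<xi>) = (LINT x|lborel. cnj (cis (- (x * \<xi>)) * f x))"
    unfolding fourier_def by (rule Bochner_Integration.integral_cnj[symmetric])
  then show ?thesis by (simp add: fourier_def cis_cnj)
qed

text \<open>
  Pairing \<open>f\<close> with its conjugate in \<open>fourier_gauss_pairing\<close> bounds the Gaussian-weighted integral of
  \<open>\<bar>fourier f\<bar>\<^sup>2\<close> uniformly in the weight; Fatou's lemma removes the weight.
\<close>
lemma plancherel_le:
  fixes f :: "real \<Rightarrow> complex"
  assumes f: "integrable lborel f"
  shows "(\<integral>\<^sup>+\<xi>. ennreal ((cmod (fourier f \<xi>))\<^sup>2) \<partial>lborel) \<le> ennreal (2 * pi) * (\<integral>\<^sup>+x. ennreal ((cmod (f x))\<^sup>2) \<partial>lborel)"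
    (is "_ \<le> ?R")
proof -
  have [measurable]: "f \<in> borel_measurable borel"
    using borel_measurable_integrable[OF f] by simp
  let ?u = "\<lambda>n \<xi>. (cmod (fourier f \<xi>))\<^sup>2 * exp (- (\<xi> / real (Suc n))\<^sup>2 / 2)"
  let ?c = "LINT x|lborel. cmod (f x)"
  have step: "(\<integral>\<^sup>+\<xi>. ennreal (?u n \<xi>) \<partial>lborel) \<le> ?R" for n
  proof -
    have g: "integrable lborel (\<lambda>\<xi>. exp (- (\<xi> / real (Suc n))\<^sup>2 / 2))"
      using integrable_norm[OF integrable_gauss[of n]] by (simp add: gauss_def)
    have int: "integrable lborel (?u n)"
    proof (rule Bochner_Integration.integrable_bound)
      show "integrable lborel (\<lambda>\<xi>. ?c\<^sup>2 * exp (- (\<xi> / real (Suc n))\<^sup>2 / 2))"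
        using g by simp
      show "AE \<xi> in lborel. norm (?u n \<xi>) \<le> norm (?c\<^sup>2 * exp (- (\<xi> / real (Suc n))\<^sup>2 / 2))"
        using norm_fourier_le[of f] by (intro AE_I2) (auto intro!: mult_right_mono power_mono)
    qed measurable
    have eq: "fourier (\<lambda>x. cnj (f x)) (- \<xi>) * fourier f \<xi> * gauss n \<xi> = complex_of_real (?u n \<xi>)" for \<xi>
      unfolding of_real_mult complex_norm_square by (simp add: fourier_cnj gauss_def mult.commute)
    have "complex_of_real (LINT \<xi>|lborel. ?u n \<xi>) = (LINT \<xi>|lborel. fourier (\<lambda>x. cnj (f x)) (- \<xi>) * fourier f \<xi> * gauss n \<xi>)"
      unfolding eq by (rule integral_of_real[OF int, symmetric])
    also have "\<dots> = 2 * pi * (LINT y|lborel. f y * (LINT x|lborel. cnj (f x) * heat_kernel n (x - y)))" (is "_ = _ * ?J")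
      using f by (intro fourier_gauss_pairing) auto
    finally have "complex_of_real (LINT \<xi>|lborel. ?u n \<xi>) = 2 * pi * ?J" .
    from arg_cong[OF this, of cmod] have "\<bar>LINT \<xi>|lborel. ?u n \<xi>\<bar> = cmod (2 * pi * ?J)"
      by (simp only: norm_of_real)
    then have "(LINT \<xi>|lborel. ?u n \<xi>) \<le> 2 * pi * cmod ?J"
      by (simp add: norm_mult)
    then have "(\<integral>\<^sup>+\<xi>. ennreal (?u n \<xi>) \<partial>lborel) \<le> ennreal (2 * pi * cmod ?J)"
      by (subst nn_integral_eq_integral[OF int]) (auto intro: ennreal_leI)
    also have "\<dots> = ennreal (2 * pi) * ennreal (cmod ?J)"
      by (simp add: ennreal_mult)
    also have "ennreal (cmod ?J) \<le> (\<integral>\<^sup>+y. ennreal (cmod (f y * (LINT x|lborel. cnj (f x) * heat_kernel n (x - y)))) \<partial>lborel)"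
      by (rule norm_integral_le_nn_integral)
    also have "\<dots> \<le> (\<integral>\<^sup>+y. ennreal (cmod (f y)) * (\<integral>\<^sup>+x. ennreal (cmod (f x) * heat_kernel n (x - y)) \<partial>lborel) \<partial>lborel)"
    proof (rule nn_integral_mono)
      fix y
      have "ennreal (cmod (LINT x|lborel. cnj (f x) * heat_kernel n (x - y))) \<le> (\<integral>\<^sup>+x. ennreal (cmod (f x) * heat_kernel n (x - y)) \<partial>lborel)"
        using norm_integral_le_nn_integral[of lborel "\<lambda>x. cnj (f x) * heat_kernel n (x - y)"]
        by (simp add: norm_mult heat_kernel_nonneg)
      then show "ennreal (cmod (f y * (LINT x|lborel. cnj (f x) * heat_kernel n (x - y)))) \<le> ennreal (cmod (f y)) * (\<integral>\<^sup>+x. ennreal (cmod (f x) * heat_kernel n (x - y)) \<partial>lborel)"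
        by (simp add: norm_mult ennreal_mult mult_left_mono)
    qed
    also have "\<dots> \<le> (\<integral>\<^sup>+x. ennreal ((cmod (f x))\<^sup>2) \<partial>lborel)"
      by (rule heat_kernel_schur) measurable
    finally show ?thesis by (simp add: mult_left_mono)
  qed
  have "(\<integral>\<^sup>+\<xi>. ennreal ((cmod (fourier f \<xi>))\<^sup>2) \<partial>lborel) = (\<integral>\<^sup>+\<xi>. liminf (\<lambda>n. ennreal (?u n \<xi>)) \<partial>lborel)"
  proof (rule nn_integral_cong)
    fix \<xi>
    have "(\<lambda>n. ?u n \<xi>) \<longlonglongrightarrow> (cmod (fourier f \<xi>))\<^sup>2 * 1"
      by (intro tendsto_mult tendsto_const gauss_tendsto)
    then have "(\<lambda>n. ennreal (?u n \<xi>)) \<longlonglongrightarrow> ennreal ((cmod (fourier f \<xi>))\<^sup>2)"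
      by (intro tendsto_ennrealI) simp
    then show "ennreal ((cmod (fourier f \<xi>))\<^sup>2) = liminf (\<lambda>n. ennreal (?u n \<xi>))"
      by (intro lim_imp_Liminf[symmetric]) simp_all
  qed
  also have "\<dots> \<le> liminf (\<lambda>n. \<integral>\<^sup>+\<xi>. ennreal (?u n \<xi>) \<partial>lborel)"
    by (rule nn_integral_liminf) measurable
  also have "\<dots> \<le> limsup (\<lambda>n. \<integral>\<^sup>+\<xi>. ennreal (?u n \<xi>) \<partial>lborel)"
    by (rule Liminf_le_Limsup) simp
  also have "\<dots> \<le> ?R"
    using step by (intro Limsup_bounded always_eventually allI)
  finally show ?thesis .
qed

section \<open>A function is bounded by the integral of its transform\<close>

text \<open>
  Otherwise, by inner regularity, the set where \<open>v > M\<close> contains a compact set of positive measure, and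
  the average of \<open>v\<close> over it exceeds \<open>M\<close>.
\<close>
lemma AE_le_of_compact_integrals:
  fixes v :: "real \<Rightarrow> real"
  assumes v: "integrable lborel v"
    and le: "\<And>T. compact T \<Longrightarrow> (LINT x|lborel. indicator T x * v x) \<le> M * measure lborel T"
  shows "AE x in lborel. v x \<le> M"
proof -
  have [measurable]: "v \<in> borel_measurable borel"
    using borel_measurable_integrable[OF v] by simp
  define A where "A n = {x. M < v x} \<inter> cball 0 (real n)" for n
  have [measurable]: "A n \<in> sets borel" for n
    unfolding A_def by measurable
  have null: "emeasure lborel (A n) = 0" for n
  proof (rule ccontr)
    assume pos: "emeasure lborel (A n) \<noteq> 0"
    have "emeasure lborel (A n) \<le> emeasure lborel (cball (0::real) (real n))"
      unfolding A_def by (rule emeasure_mono[OF Int_lower2]) simp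
    also have "\<dots> < \<infinity>"
      by (rule emeasure_bounded_finite[OF bounded_cball])
    finally have fin: "emeasure lborel (A n) < \<infinity>" .
    have mpos: "measure lborel (A n) > 0"
      using pos fin by (metis emeasure_eq_ennreal_measure ennreal_eq_0_iff less_top not_le infinity_ennreal_def)
    obtain T where T: "closed T" "T \<subseteq> A n" "emeasure lebesgue (A n - T) < ennreal (measure lborel (A n))"
    proof (rule sets_lebesgue_inner_closed[OF _ mpos])
      show "A n \<in> sets lebesgue" by simp
    qed
    have cT: "compact T"
      using T(1,2) by (auto simp: A_def compact_eq_bounded_closed intro: bounded_subset[OF bounded_cball])
    have [measurable]: "T \<in> sets borel" using T(1) by simp
    have Tpos: "emeasure lborel T \<noteq> 0"
    proof
      assume "emeasure lborel T = 0"
      then have "emeasure lborel (A n - T) = emeasure lborel (A n)"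
        by (intro emeasure_Diff_null_set) auto
      with T(3) fin show False
        by (simp add: emeasure_eq_ennreal_measure)
    qed
    have Tfin: "emeasure lborel T < \<infinity>"
      using cT by (rule emeasure_compact_finite)
    have iT: "integrable lborel (\<lambda>x. indicator T x * v x)"
      using integrable_mult_indicator[OF _ v, of T] by simp
    have iM: "integrable lborel (\<lambda>x. indicator T x * M)"
      using Tfin by (intro integrable_mult_left integrable_real_indicator) auto
    let ?d = "\<lambda>x. indicator T x * v x - indicator T x * M"
    have id: "integrable lborel ?d" using iT iM by (rule Bochner_Integration.integrable_diff)
    have dnn: "0 \<le> ?d x" for x
      using T(2) by (auto simp: A_def indicator_def)
    have "(LINT x|lborel. ?d x) = (LINT x|lborel. indicator T x * v x) - M * measure lborel T"
      using iT iM Tfin by (simp add: mult.commute)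
    then have "(LINT x|lborel. ?d x) \<le> 0" using le[OF cT] by simp
    moreover have "(LINT x|lborel. ?d x) \<ge> 0" using dnn by (intro integral_nonneg_AE AE_I2)
    ultimately have "AE x in lborel. ?d x = 0"
      using integral_nonneg_eq_0_iff_AE[OF id] dnn by auto
    then have "AE x in lborel. x \<notin> T"
      by eventually_elim (use T(2) in \<open>auto simp: A_def indicator_def split: if_splits\<close>)
    then show False
      using Tpos by (subst (asm) AE_iff_null_sets[symmetric]) auto
  qed
  have "AE x in lborel. \<forall>n. x \<notin> A n"
    unfolding AE_all_countable
  proof
    fix n
    show "AE x in lborel. x \<notin> A n" by (intro AE_not_in null_setsI null) simp
  qed
  then show ?thesis
  proof eventually_elim
    case (elim x)
    show ?case
    proof (rule ccontr)
      assume "\<not> v x \<le> M"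
      moreover obtain n where "\<bar>x\<bar> \<le> real n" using real_arch_simple by blast
      ultimately have "x \<in> A n" by (simp add: A_def)
      with elim show False by blast
    qed
  qed
qed

text \<open>
  By Parseval's formula, the integral of \<open>w\<close> against a nonnegative continuous function \<open>p\<close> of compact
  support is at most \<open>1 / (2 \<pi>)\<close> times the \<open>L\<^sup>1\<close> norms of \<open>fourier w\<close> and \<open>p\<close>, because
  \<open>\<bar>fourier p\<bar>\<close> is bounded by the integral of \<open>p\<close>. The indicator function of \<open>T\<close> is a decreasing
  limit of such functions.
\<close>
lemma compact_integral_le_fourier:
  fixes w :: "real \<Rightarrow> complex"
  assumes w: "integrable lborel w" and W: "integrable lborel (fourier w)" and T: "compact T"
  shows "cmod (LINT x|lborel. indicator T x * w x)
    \<le> (LINT \<xi>|lborel. cmod (fourier w \<xi>)) / (2 * pi) * measure lborel T"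
proof (cases "T = {}")
  case False
  have [measurable]: "w \<in> borel_measurable borel"
    using borel_measurable_integrable[OF w] by simp
  have [measurable]: "T \<in> sets borel" using T by (simp add: compact_imp_closed)
  let ?B = "LINT \<xi>|lborel. cmod (fourier w \<xi>)"
  define p where "p n x = max 0 (1 - real (Suc n) * infdist x T)" for n x
  have pc: "continuous_on UNIV (p n)" for n
    unfolding p_def by (intro continuous_intros)
  have [measurable]: "p n \<in> borel_measurable borel" for n
    using pc by (rule borel_measurable_continuous_onI)
  have p0: "0 \<le> p n x" and p1: "p n x \<le> 1" for n x
    using infdist_nonneg[of x T] by (auto simp: p_def)
  define S where "S = {x. infdist x T \<le> 1}"
  have cS: "compact S"
    unfolding S_def using T False by (intro compact_infdist_le) auto
  have pS: "p n x \<le> indicator S x" for n x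
  proof (cases "x \<in> S")
    case False
    then have "1 * 1 \<le> real (Suc n) * infdist x T" by (intro mult_mono) (auto simp: S_def)
    then show ?thesis using False by (simp add: p_def)
  qed (use p1 in auto)
  have plim: "(\<lambda>n. p n x) \<longlonglongrightarrow> indicator T x" for x
  proof (cases "x \<in> T")
    case True
    then show ?thesis by (simp add: p_def)
  next
    case F: False
    then have d: "0 < infdist x T"
      using T False by (simp add: infdist_pos_not_in_closed compact_imp_closed)
    obtain m where "1 / infdist x T \<le> real m" using real_arch_simple by blast
    then have m: "1 \<le> real m * infdist x T" using d by (simp add: field_simps)
    have "p n x = 0" if "n \<ge> m" for n
    proof -
      have "real m * infdist x T \<le> real (Suc n) * infdist x T"
        using that d by (intro mult_right_mono) auto
      then show ?thesis using m by (simp add: p_def)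
    qed
    then show ?thesis using F
      by (auto intro!: tendsto_eventually eventually_sequentiallyI[of m])
  qed
  have iS: "integrable lborel (\<lambda>x. indicator S x :: real)"
    using cS emeasure_compact_finite[OF cS] by (intro integrable_real_indicator) (auto simp: compact_imp_closed)
  have pint: "integrable lborel (p n)" for n
    by (rule Bochner_Integration.integrable_bound[OF iS]) (auto intro!: AE_I2 simp: p0 pS)
  have bound: "cmod (LINT x|lborel. p n x * w x) \<le> ?B / (2 * pi) * (LINT x|lborel. p n x)" for n
  proof -
    let ?P = "LINT x|lborel. p n x"
    let ?h = "\<lambda>x. complex_of_real (p n x)"
    have h: "integrable lborel ?h" using pint by simp
    have P0: "0 \<le> ?P" using p0 by (intro integral_nonneg_AE AE_I2)
    have hb: "cmod (fourier ?h \<xi>) \<le> ?P" for \<xi>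
      using norm_fourier_le[of ?h \<xi>] by (simp add: p0)
    have bd: "cmod (fourier ?h (- \<xi>) * fourier w \<xi>) \<le> ?P * cmod (fourier w \<xi>)" for \<xi>
      by (simp add: norm_mult mult_right_mono hb)
    have PB: "integrable lborel (\<lambda>\<xi>. ?P * cmod (fourier w \<xi>))"
      using W by (simp add: integrable_norm)
    have int: "integrable lborel (\<lambda>\<xi>. fourier ?h (- \<xi>) * fourier w \<xi>)"
      by (rule Bochner_Integration.integrable_bound[OF PB]) (auto intro!: AE_I2 order_trans[OF bd])
    have "(LINT \<xi>|lborel. fourier ?h (- \<xi>) * fourier w \<xi>) = 2 * pi * (LINT x|lborel. ?h x * w x)"
      using pc by (intro parseval[where B = 1] h w int continuous_on_of_real) (simp_all add: p0 p1)
    moreover have "cmod (LINT \<xi>|lborel. fourier ?h (- \<xi>) * fourier w \<xi>) \<le> (LINT \<xi>|lborel. ?P * cmod (fourier w \<xi>))"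
      by (rule Bochner_Integration.integral_norm_bound_integral[OF int PB bd])
    ultimately have "2 * pi * cmod (LINT x|lborel. ?h x * w x) \<le> ?P * ?B"
      by (simp add: norm_mult)
    then show ?thesis by (simp add: field_simps)
  qed
  have "(\<lambda>n. LINT x|lborel. p n x * w x) \<longlonglongrightarrow> (LINT x|lborel. complex_of_real (indicator T x) * w x)"
  proof (rule integral_dominated_convergence[OF _ _ integrable_norm[OF w]])
    show "AE x in lborel. (\<lambda>n. p n x * w x) \<longlonglongrightarrow> complex_of_real (indicator T x) * w x"
      using plim by (intro AE_I2 tendsto_intros)
    show "AE x in lborel. cmod (p n x * w x) \<le> cmod (w x)" for n
      by (intro AE_I2) (auto simp: norm_mult p0 p1 intro!: mult_left_le_one_le)
  qed measurable
  then have L: "(\<lambda>n. cmod (LINT x|lborel. p n x * w x)) \<longlonglongrightarrow> cmod (LINT x|lborel. indicator T x * w x)"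
    using tendsto_norm by (simp only: of_real_indicator) fastforce
  have "(\<lambda>n. LINT x|lborel. p n x) \<longlonglongrightarrow> (LINT x|lborel. indicator T x)"
    by (rule integral_dominated_convergence[OF _ _ iS]) (auto simp: plim p0 pS)
  then have R: "(\<lambda>n. ?B / (2 * pi) * (LINT x|lborel. p n x)) \<longlonglongrightarrow> ?B / (2 * pi) * measure lborel T"
    using emeasure_compact_finite[OF T] by (intro tendsto_intros) simp
  show ?thesis
    using LIMSEQ_le[OF L R] bound by blast
qed simp

text \<open>
  The sharp constant is \<open>1 / (2 \<pi>)\<close>; estimating the real and imaginary parts separately, with the
  unimodular factors \<open>1, -1, \<i>, -\<i>\<close>, costs a factor of at most \<open>2\<close>.
\<close>
lemma AE_cmod_le_fourier:
  fixes w :: "real \<Rightarrow> complex"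
  assumes w: "integrable lborel w" and W: "integrable lborel (fourier w)"
  shows "AE x in lborel. cmod (w x) \<le> (LINT \<xi>|lborel. cmod (fourier w \<xi>)) / pi"
proof -
  let ?M = "(LINT \<xi>|lborel. cmod (fourier w \<xi>)) / (2 * pi)"
  have *: "AE x in lborel. Re (c * w x) \<le> ?M" if c: "cmod c = 1" for c
  proof (rule AE_le_of_compact_integrals)
    show "integrable lborel (\<lambda>x. Re (c * w x))"
      using w by (intro integrable_Re integrable_mult_right)
    fix T :: "real set" assume T: "compact T"
    then have [measurable]: "T \<in> sets borel" by (simp add: compact_imp_closed)
    have i: "integrable lborel (\<lambda>x. indicator T x * w x)"
      using integrable_mult_indicator[OF _ w, of T] by (simp add: scaleR_conv_of_real of_real_indicator)
    have "(LINT x|lborel. indicator T x * Re (c * w x)) = (LINT x|lborel. Re (c * (indicator T x * w x)))"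
      by (intro Bochner_Integration.integral_cong refl) (simp add: indicator_def)
    also have "\<dots> = Re (c * (LINT x|lborel. indicator T x * w x))"
      using i by (subst integral_Re) simp_all
    also have "\<dots> \<le> cmod (c * (LINT x|lborel. indicator T x * w x))"
      by (rule complex_Re_le_cmod)
    also have "\<dots> \<le> ?M * measure lborel T"
      using compact_integral_le_fourier[OF w W T] c by (simp add: norm_mult)
    finally show "(LINT x|lborel. indicator T x * Re (c * w x)) \<le> ?M * measure lborel T" .
  qed
  have "AE x in lborel. Re (w x) \<le> ?M" "AE x in lborel. - Re (w x) \<le> ?M"
    "AE x in lborel. - Im (w x) \<le> ?M" "AE x in lborel. Im (w x) \<le> ?M"
    using *[of 1] *[of "-1"] *[of "\<i>"] *[of "-\<i>"] by simp_all
  then show ?thesis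
  proof eventually_elim
    case (elim x)
    have "cmod (w x) \<le> \<bar>Re (w x)\<bar> + \<bar>Im (w x)\<bar>" by (rule cmod_le)
    also have "\<dots> \<le> ?M + ?M" using elim by linarith
    finally show ?case by simp
  qed
qed

section \<open>Modulated smooth bump functions\<close>

text \<open>
  The functions \<open>t\<^sup>-\<^sup>n exp (- 1 / t)\<close>, extended by \<open>0\<close> to \<open>t \<le> 0\<close>. Keeping the exponent \<open>n\<close> as an
  index makes the family closed under differentiation.
\<close>
definition flat_exp :: "nat \<Rightarrow> real \<Rightarrow> real" where
  "flat_exp n t = (if t > 0 then exp (- 1 / t) / t ^ n else 0)"

lemma flat_exp_Suc: "t * flat_exp (Suc n) t = flat_exp n t"
  by (simp add: flat_exp_def)

lemma flat_exp_tendsto_0: "(flat_exp n \<longlongrightarrow> 0) (at 0)"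
proof -
  have "((\<lambda>t::real. exp (- 1 / t) / t ^ n) \<longlongrightarrow> 0) (at_right 0)"
  proof -
    have "((\<lambda>x::real. x ^ n / exp x) \<longlongrightarrow> 0) at_top" by (rule tendsto_power_div_exp_0)
    then have "((\<lambda>t::real. (inverse t) ^ n / exp (inverse t)) \<longlongrightarrow> 0) (at_right 0)"
      by (rule filterlim_compose[OF _ filterlim_inverse_at_top_right])
    then show ?thesis
      by (simp add: exp_minus field_simps)
  qed
  then have "(flat_exp n \<longlongrightarrow> 0) (at_right 0)"
    by (rule Lim_transform_eventually) (auto simp: flat_exp_def eventually_at_filter)
  moreover have "(flat_exp n \<longlongrightarrow> 0) (at_left 0)"
    by (rule tendsto_eventually) (auto simp: flat_exp_def eventually_at_filter)
  ultimately show ?thesis by (simp add: filterlim_split_at_real)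
qed

lemma flat_exp_deriv:
  "(flat_exp n has_real_derivative flat_exp (n + 2) t - real n * flat_exp (n + 1) t) (at t)"
proof -
  consider "t > 0" | "t < 0" | "t = 0" by linarith
  then show ?thesis
  proof cases
    case 1
    have "((\<lambda>t. exp (- 1 / t) * (inverse t) ^ n) has_real_derivative flat_exp (n + 2) t - real n * flat_exp (n + 1) t) (at t)"
      using 1 by (auto intro!: derivative_eq_intros simp: flat_exp_def field_simps power2_eq_square)
        (cases n; simp add: field_simps)
    then show ?thesis
      by (rule has_field_derivative_transform_within_open[where S = "{0<..}"])
         (use 1 in \<open>auto simp: flat_exp_def field_simps\<close>)
  next
    case 2
    have "((\<lambda>t. 0) has_real_derivative 0) (at t)" by simp
    then have "(flat_exp n has_real_derivative 0) (at t)"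
      by (rule has_field_derivative_transform_within_open[where S = "{..<0}"])
         (use 2 in \<open>auto simp: flat_exp_def\<close>)
    then show ?thesis using 2 by (simp add: flat_exp_def)
  next
    case 3
    have "((\<lambda>y. (flat_exp n y - flat_exp n 0) / (y - 0)) \<longlongrightarrow> 0) (at 0)"
    proof (rule Lim_transform_eventually[OF flat_exp_tendsto_0[of "Suc n"]])
      show "\<forall>\<^sub>F y in at 0. flat_exp (Suc n) y = (flat_exp n y - flat_exp n 0) / (y - 0)"
        using flat_exp_Suc[of _ n] by (auto simp: eventually_at_filter flat_exp_def)
    qed
    then show ?thesis using 3 by (simp add: has_field_derivative_iff flat_exp_def)
  qed
qed

text \<open>
  With \<open>p = 1\<close> and \<open>n = 0\<close> this is the standard bump function on \<open>(-r, r)\<close>, modulated to frequency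
  \<open>- \<eta>\<close>. The polynomial factor and the index \<open>n\<close> make the class closed under differentiation, which
  yields derivatives of all orders at once.
\<close>
definition bump :: "real \<Rightarrow> real \<Rightarrow> complex poly \<Rightarrow> nat \<Rightarrow> real \<Rightarrow> complex" where
  "bump r \<eta> p n x = poly p (complex_of_real x) * flat_exp n (r\<^sup>2 - x\<^sup>2) * cis (- (x * \<eta>))"

lemma has_vector_derivative_character:
  "((\<lambda>x. cis (- (x * \<eta>))) has_vector_derivative - (\<i> * \<eta>) * cis (- (x * \<eta>))) (at x)"
proof -
  have "((\<lambda>z. exp (- (\<i> * \<eta>) * z)) has_field_derivative exp (- (\<i> * \<eta>) * complex_of_real x) * - (\<i> * \<eta>)) (at (complex_of_real x))"
    by (auto intro!: derivative_eq_intros)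
  from has_vector_derivative_real_field[OF this]
  show ?thesis by (simp add: cis_conv_exp mult_ac)
qed

text \<open>
  The three terms of the product rule are brought over the common factor \<open>flat_exp (n + 2)\<close> by
  \<open>flat_exp_Suc\<close>, so that \<open>p\<close> is replaced by a polynomial and \<open>n\<close> by \<open>n + 2\<close>.
\<close>
lemma bump_deriv:
  "\<exists>q m. \<forall>x. (bump r \<eta> p n has_vector_derivative bump r \<eta> q m x) (at x)"
proof (intro exI allI)
  fix x
  define Q where "Q = [:complex_of_real (r\<^sup>2), 0, -1:]"
  let ?q = "pderiv p * Q\<^sup>2 + p * [:0, -2:] - smult (of_nat n) (p * [:0, -2:] * Q) - smult (\<i> * \<eta>) (p * Q\<^sup>2)"
  let ?t = "r\<^sup>2 - x\<^sup>2"
  have Q: "poly Q (complex_of_real x) = complex_of_real ?t"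
    by (simp add: Q_def power2_eq_square algebra_simps)
  have 1: "((\<lambda>x. poly p (complex_of_real x)) has_vector_derivative poly (pderiv p) (complex_of_real x)) (at x)"
    by (rule has_vector_derivative_real_field[OF poly_DERIV])
  have "((\<lambda>x. flat_exp n (r\<^sup>2 - x\<^sup>2)) has_real_derivative (flat_exp (n + 2) ?t - real n * flat_exp (n + 1) ?t) * (- 2 * x)) (at x)"
    by (rule DERIV_chain2[OF flat_exp_deriv]) (auto intro!: derivative_eq_intros)
  then have 2: "((\<lambda>x. complex_of_real (flat_exp n (r\<^sup>2 - x\<^sup>2))) has_vector_derivative
      complex_of_real ((flat_exp (n + 2) ?t - real n * flat_exp (n + 1) ?t) * (- 2 * x))) (at x)"
    by (intro has_vector_derivative_of_real) (simp add: has_real_derivative_iff_has_vector_derivative)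
  have 3: "((\<lambda>x. cis (- (x * \<eta>))) has_vector_derivative - (\<i> * \<eta>) * cis (- (x * \<eta>))) (at x)"
    by (rule has_vector_derivative_character)
  have e1: "flat_exp n ?t = ?t\<^sup>2 * flat_exp (n + 2) ?t" "flat_exp (n + 1) ?t = ?t * flat_exp (n + 2) ?t"
    using flat_exp_Suc[of ?t n] flat_exp_Suc[of ?t "Suc n"] by (simp_all add: power2_eq_square mult.assoc)
  have "bump r \<eta> ?q (n + 2) x = poly p (complex_of_real x) * flat_exp n ?t * (- (\<i> * \<eta>) * cis (- (x * \<eta>)))
     + (poly p (complex_of_real x) * complex_of_real ((flat_exp (n + 2) ?t - real n * flat_exp (n + 1) ?t) * (- 2 * x))
     + poly (pderiv p) (complex_of_real x) * flat_exp n ?t) * cis (- (x * \<eta>))"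
    unfolding e1 bump_def by (simp add: Q algebra_simps power2_eq_square)
  then show "(bump r \<eta> p n has_vector_derivative bump r \<eta> ?q (n + 2) x) (at x)"
    unfolding bump_def[of r \<eta> p n, abs_def]
    by (simp only:) (intro has_vector_derivative_mult 1 2 3)
qed

text \<open>
  If the derivative of each member of a family is again a member, iterating the choice of a derivative
  gives all higher derivatives.
\<close>
lemma smooth_of_closed_class:
  fixes f :: "'i \<Rightarrow> real \<Rightarrow> complex"
  assumes "\<And>i. \<exists>j. \<forall>x. (f i has_vector_derivative f j x) (at x)"
  shows "\<exists>D :: nat \<Rightarrow> real \<Rightarrow> complex. D 0 = f i \<and> (\<forall>k. D k \<in> range f) \<and>
    (\<forall>k x. (D k has_vector_derivative D (Suc k) x) (at x))"
proof -
  obtain d where d: "\<And>i x. (f i has_vector_derivative f (d i) x) (at x)"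
    using assms by metis
  show ?thesis
    using d by (intro exI[of _ "\<lambda>k. f ((d ^^ k) i)"]) auto
qed

lemma bump_smooth:
  "\<exists>D :: nat \<Rightarrow> real \<Rightarrow> complex. D 0 = bump r \<eta> p n \<and> (\<forall>k. \<exists>q m. D k = bump r \<eta> q m) \<and>
    (\<forall>k x. (D k has_vector_derivative D (Suc k) x) (at x))"
proof -
  let ?f = "\<lambda>i. bump r \<eta> (fst i) (snd i)"
  have "\<exists>j. \<forall>x. (?f i has_vector_derivative ?f j x) (at x)" for i
  proof -
    obtain q m where "\<forall>x. (?f i has_vector_derivative bump r \<eta> q m x) (at x)"
      using bump_deriv[of r \<eta> "fst i" "snd i"] by (elim exE) (rule that)
    then show ?thesis by (intro exI[of _ "(q, m)"]) simp
  qed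
  from smooth_of_closed_class[of ?f, OF this, of "(p, n)"]
  obtain D where D: "D 0 = bump r \<eta> p n" "\<And>k. D k \<in> range ?f"
    "\<And>k x. (D k has_vector_derivative D (Suc k) x) (at x)"
    unfolding fst_conv snd_conv by (elim exE conjE) (rule that, assumption, blast+)
  have "\<exists>q m. D k = bump r \<eta> q m" for k
    using D(2)[of k] by (elim imageE) (intro exI)
  with D(1,3) show ?thesis by (intro exI[of _ D] conjI allI)
qed

lemma bump_eq_0: "r > 0 \<Longrightarrow> x \<notin> {-r<..<r} \<Longrightarrow> bump r \<eta> p n x = 0"
proof -
  assume "r > 0" "x \<notin> {-r<..<r}"
  then have "r \<le> \<bar>x\<bar>" by auto
  then have "r\<^sup>2 \<le> x\<^sup>2" using \<open>r > 0\<close> by (simp add: abs_le_square_iff[symmetric])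
  then show ?thesis by (simp add: bump_def flat_exp_def)
qed

lemma continuous_on_bump: "continuous_on UNIV (bump r \<eta> p n)"
  using bump_deriv[of r \<eta> p n] has_vector_derivative_continuous
  by (metis continuous_at_imp_continuous_on)

lemma bump_test_function:
  assumes "0 < r" "r < 1"
  shows "bump r \<eta> p n \<in> test_functions {-1<..<1}"
  unfolding test_functions_def
proof (intro CollectI conjI)
  show "\<exists>D. D 0 = bump r \<eta> p n \<and> (\<forall>k x. (D k has_vector_derivative D (Suc k) x) (at x))"
    using bump_smooth[of r \<eta> p n] by auto
  show "\<exists>S. compact S \<and> S \<subseteq> {-1<..<1} \<and> (\<forall>x. x \<notin> S \<longrightarrow> bump r \<eta> p n x = 0)"
    using assms by (intro exI[of _ "{-r..r}"]) (auto intro!: bump_eq_0)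
qed

lemma integrable_bump:
  assumes "0 < r"
  shows "integrable lborel (bump r \<eta> p n)"
proof -
  have "integrable lborel (\<lambda>x. indicator {-r..r} x *\<^sub>R bump r \<eta> p n x)"
    by (rule borel_integrable_compact) (auto intro: continuous_on_subset[OF continuous_on_bump])
  also have "(\<lambda>x. indicator {-r..r} x *\<^sub>R bump r \<eta> p n x) = bump r \<eta> p n"
    using bump_eq_0[OF assms] by (auto simp: indicator_def fun_eq_iff)
  finally show ?thesis .
qed

lemma bounded_bump:
  assumes "0 < r"
  shows "\<exists>B. \<forall>x. cmod (bump r \<eta> p n x) \<le> B"
proof -
  have "bounded (bump r \<eta> p n ` {-r..r})"
    by (intro compact_imp_bounded compact_continuous_image continuous_on_subset[OF continuous_on_bump]) auto
  then obtain B where B: "\<forall>x\<in>{-r..r}. cmod (bump r \<eta> p n x) \<le> B"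
    by (auto simp: bounded_iff)
  have "cmod (bump r \<eta> p n x) \<le> max B 0" for x
    using B bump_eq_0[OF assms, of x \<eta> p n] by (cases "x \<in> {-r..r}") (auto simp: le_max_iff_disj)
  then show ?thesis by blast
qed

lemma fourier_derivative:
  assumes r: "0 < r" and D: "\<And>x. (u has_vector_derivative v x) (at x)"
    and u: "\<And>x. x \<notin> {-r<..<r} \<Longrightarrow> u x = 0" and v: "\<And>x. x \<notin> {-r<..<r} \<Longrightarrow> v x = 0"
    and vc: "continuous_on UNIV v"
  shows "fourier v \<zeta> = \<i> * \<zeta> * fourier u \<zeta>"
proof -
  have uc: "continuous_on UNIV u"
    using D has_vector_derivative_continuous by (metis continuous_at_imp_continuous_on)
  have ind: "(LINT x|lborel. cis (- (x * \<zeta>)) * w x) = (LINT x|lborel. indicator {-r..r} x *\<^sub>R (cis (- (x * \<zeta>)) * w x))"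
    if "\<And>x. x \<notin> {-r<..<r} \<Longrightarrow> w x = 0" for w
    using that by (intro Bochner_Integration.integral_cong refl) (auto simp: indicator_def)
  have iu: "(LINT x|lborel. cis (- (x * \<zeta>)) * u x) = (LINT x|lborel. indicator {-r..r} x *\<^sub>R (cis (- (x * \<zeta>)) * u x))"
    by (rule ind) (rule u)
  have iv: "(LINT x|lborel. cis (- (x * \<zeta>)) * v x) = (LINT x|lborel. indicator {-r..r} x *\<^sub>R (cis (- (x * \<zeta>)) * v x))"
    by (rule ind) (rule v)
  have int: "integrable lborel (\<lambda>x. indicator {-r..r} x *\<^sub>R (cis (- (x * \<zeta>)) * w x))" if "continuous_on UNIV w" for w
    by (rule borel_integrable_compact) (auto intro!: continuous_intros intro: continuous_on_subset[OF that])
  have "(LINT x|lborel. indicator {-r..r} x *\<^sub>R (cis (- (x * \<zeta>)) * v x - \<i> * \<zeta> * (cis (- (x * \<zeta>)) * u x)))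
      = cis (- (r * \<zeta>)) * u r - cis (- (- r * \<zeta>)) * u (- r)"
  proof (rule integral_FTC_atLeastAtMost)
    show "- r \<le> r" using r by simp
    fix x
    have "((\<lambda>x. cis (- (x * \<zeta>))) has_vector_derivative - (\<i> * \<zeta>) * cis (- (x * \<zeta>))) (at x)"
      by (rule has_vector_derivative_character)
    then have "((\<lambda>x. cis (- (x * \<zeta>)) * u x) has_vector_derivative
        cis (- (x * \<zeta>)) * v x + - (\<i> * \<zeta>) * cis (- (x * \<zeta>)) * u x) (at x)"
      by (rule has_vector_derivative_mult[OF _ D])
    moreover have "cis (- (x * \<zeta>)) * v x + - (\<i> * \<zeta>) * cis (- (x * \<zeta>)) * u x
        = cis (- (x * \<zeta>)) * v x - \<i> * \<zeta> * (cis (- (x * \<zeta>)) * u x)"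
      by simp
    ultimately show "((\<lambda>x. cis (- (x * \<zeta>)) * u x) has_vector_derivative
        cis (- (x * \<zeta>)) * v x - \<i> * \<zeta> * (cis (- (x * \<zeta>)) * u x)) (at x within {-r..r})"
      by (simp only: has_vector_derivative_at_within)
  next
    show "continuous_on {-r..r} (\<lambda>x. cis (- (x * \<zeta>)) * v x - \<i> * \<zeta> * (cis (- (x * \<zeta>)) * u x))"
      by (intro continuous_intros continuous_on_subset[OF uc] continuous_on_subset[OF vc]) auto
  qed
  also have "\<dots> = 0" using u by simp
  also have "(LINT x|lborel. indicator {-r..r} x *\<^sub>R (cis (- (x * \<zeta>)) * v x - \<i> * \<zeta> * (cis (- (x * \<zeta>)) * u x)))
    = (LINT x|lborel. indicator {-r..r} x *\<^sub>R (cis (- (x * \<zeta>)) * v x) - \<i> * \<zeta> * (indicator {-r..r} x *\<^sub>R (cis (- (x * \<zeta>)) * u x)))"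
    by (intro Bochner_Integration.integral_cong refl) (simp add: indicator_def)
  also have "\<dots> = fourier v \<zeta> - \<i> * \<zeta> * fourier u \<zeta>"
    by (subst Bochner_Integration.integral_diff[OF int[OF vc] integrable_mult_right[OF int[OF uc]]])
       (simp only: integral_mult_right_zero fourier_def iu iv)
  finally show ?thesis by simp
qed

text \<open>
  Four integrations by parts. The power \<open>4\<close> of decay is what the commutator estimate needs: one factor
  \<open>1 + \<zeta>\<^sup>2\<close> is spent on the difference of the symbols, and the other one leaves an integrable kernel.
\<close>
lemma fourier_bump_decay:
  assumes r: "0 < r"
  shows "\<exists>A>0. \<forall>\<zeta>. cmod (fourier (bump r \<eta> p n) \<zeta>) \<le> A / (1 + \<zeta>\<^sup>2)\<^sup>2"
proof -
  obtain D where D: "D 0 = bump r \<eta> p n" "\<And>k. \<exists>q m. D k = bump r \<eta> q m"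
    "\<And>k x. (D k has_vector_derivative D (Suc k) x) (at x)"
    using bump_smooth[of r \<eta> p n] by blast
  have 0: "D k x = 0" if "x \<notin> {-r<..<r}" for k x
    using D(2)[of k] bump_eq_0[OF r that] by auto
  have c: "continuous_on UNIV (D k)" for k
    using D(2)[of k] continuous_on_bump by auto
  have "fourier (D (Suc k)) \<zeta> = \<i> * \<zeta> * fourier (D k) \<zeta>" for k \<zeta>
    by (rule fourier_derivative[OF r]) (fact D(3) 0 c)+
  then have F: "fourier (D k) \<zeta> = (\<i> * \<zeta>) ^ k * fourier (D 0) \<zeta>" for k \<zeta>
    by (induction k) (simp_all add: mult_ac)
  define a where "a k = (LINT x|lborel. cmod (D k x))" for k
  have a: "\<bar>\<zeta>\<bar> ^ k * cmod (fourier (D 0) \<zeta>) \<le> a k" for k \<zeta>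
    using norm_fourier_le[of "D k" \<zeta>] by (simp add: F[of k] a_def norm_mult norm_power)
  have a0: "0 \<le> a k" for k unfolding a_def by (intro integral_nonneg_AE AE_I2) simp
  have "cmod (fourier (D 0) \<zeta>) \<le> (a 0 + 2 * a 2 + a 4 + 1) / (1 + \<zeta>\<^sup>2)\<^sup>2" for \<zeta>
  proof -
    have "cmod (fourier (D 0) \<zeta>) * (1 + \<zeta>\<^sup>2)\<^sup>2
      = \<bar>\<zeta>\<bar> ^ 0 * cmod (fourier (D 0) \<zeta>) + 2 * (\<bar>\<zeta>\<bar> ^ 2 * cmod (fourier (D 0) \<zeta>)) + \<bar>\<zeta>\<bar> ^ 4 * cmod (fourier (D 0) \<zeta>)"
      by (simp add: power2_eq_square power4_eq_xxxx algebra_simps)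
    also have "\<dots> \<le> a 0 + 2 * a 2 + a 4"
      using a[of \<zeta> 0] a[of \<zeta> 2] a[of \<zeta> 4] by linarith
    also have "\<dots> \<le> a 0 + 2 * a 2 + a 4 + 1" by simp
    finally have "cmod (fourier (D 0) \<zeta>) * (1 + \<zeta>\<^sup>2)\<^sup>2 \<le> a 0 + 2 * a 2 + a 4 + 1" .
    moreover have "(1 + \<zeta>\<^sup>2)\<^sup>2 > 0"
      by (intro zero_less_power add_pos_nonneg) auto
    ultimately show ?thesis by (simp only: pos_le_divide_eq)
  qed
  moreover have "a 0 + 2 * a 2 + a 4 + 1 > 0" using a0[of 0] a0[of 2] a0[of 4] by linarith
  ultimately show ?thesis unfolding D(1) by blast
qed

section \<open>The symbol of the fractional Laplacian\<close>

lemma powr_factor: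
  fixes s :: real
  assumes "0 < s"
  shows "s powr a = s powr (a - 1) * s"
  using powr_add[of s "a - 1" 1] assms by simp

text \<open>
  As \<open>m powr (\<alpha> - 2) \<ge> s powr (\<alpha> - 2)\<close>, the left-hand side is at most
  \<open>s powr (\<alpha> - 2) * (s\<^sup>2 - m\<^sup>2)\<close>, which factors.
\<close>
lemma powr_diff_le:
  fixes m s :: real
  assumes "0 \<le> m" "m \<le> s" "0 < s" "0 < \<alpha>" "\<alpha> < 2"
  shows "s powr \<alpha> - m powr \<alpha> \<le> 2 * s powr (\<alpha> - 1) * (s - m)"
proof (cases "m = 0")
  case True
  then show ?thesis using powr_factor[of s \<alpha>] assms by simp
next
  case False
  then have m: "m > 0" using assms by simp
  have p2: "x powr \<alpha> = x powr (\<alpha> - 2) * x\<^sup>2" if "x > 0" for x :: real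
    using powr_add[of x "\<alpha> - 2" 2] that by simp
  have "s powr (\<alpha> - 2) \<le> m powr (\<alpha> - 2)"
    using assms m by (intro powr_mono2') auto
  then have "s powr (\<alpha> - 2) * m\<^sup>2 \<le> m powr \<alpha>"
    using p2[OF m] by (simp add: mult_right_mono)
  then have "s powr \<alpha> - m powr \<alpha> \<le> s powr (\<alpha> - 2) * (s\<^sup>2 - m\<^sup>2)"
    using p2[OF assms(3)] by (simp add: algebra_simps)
  also have "\<dots> = s powr (\<alpha> - 2) * ((s + m) * (s - m))"
    by (simp add: power2_eq_square algebra_simps)
  also have "\<dots> \<le> s powr (\<alpha> - 2) * ((2 * s) * (s - m))"
    using assms by (intro mult_left_mono mult_right_mono) auto
  also have "\<dots> = 2 * (s powr (\<alpha> - 2) * s) * (s - m)" by simp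
  also have "s powr (\<alpha> - 2) * s = s powr (\<alpha> - 1)"
    using powr_factor[OF assms(3), of "\<alpha> - 1"] by simp
  finally show ?thesis .
qed

lemma powr_diff_ge:
  fixes m s :: real
  assumes "0 \<le> m" "m \<le> s" "0 < s" "0 < \<alpha>"
  shows "min 1 \<alpha> * (s powr (\<alpha> - 1) * (s - m)) \<le> s powr \<alpha> - m powr \<alpha>"
proof (cases "\<alpha> \<ge> 1")
  case True
  have "m powr \<alpha> \<le> s powr (\<alpha> - 1) * m"
  proof (cases "m = 0")
    case False
    then have "m powr \<alpha> = m powr (\<alpha> - 1) * m" using powr_factor[of m \<alpha>] assms by simp
    also have "\<dots> \<le> s powr (\<alpha> - 1) * m"
      using assms True by (intro mult_right_mono powr_mono2) auto
    finally show ?thesis .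
  qed simp
  then show ?thesis using True powr_factor[OF assms(3), of \<alpha>] by (simp add: algebra_simps)
next
  case False
  \<comment> \<open>Bernoulli's inequality at the point \<open>m / s \<le> 1\<close>, i.e. concavity of the \<open>\<alpha>\<close>-th power.\<close>
  have "(m / s) powr \<alpha> \<le> 1 - \<alpha> * (1 - m / s)"
  proof (cases "m = 0")
    case False
    then have ms: "m / s > 0" using assms by simp
    have "(m / s) powr \<alpha> * 1 powr (1 - \<alpha>) \<le> \<alpha> * (m / s) + (1 - \<alpha>) * 1"
      using ms \<open>\<not> 1 \<le> \<alpha>\<close> assms by (intro Youngs_inequality_0) auto
    then show ?thesis by (simp add: algebra_simps)
  qed (use False assms in simp)
  then have "s powr \<alpha> * (m / s) powr \<alpha> \<le> s powr \<alpha> * (1 - \<alpha> * (1 - m / s))"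
    by (intro mult_left_mono) auto
  moreover have "s powr \<alpha> * (m / s) powr \<alpha> = m powr \<alpha>"
    using assms by (simp add: powr_divide)
  moreover have "s powr \<alpha> * (1 - \<alpha> * (1 - m / s)) = s powr \<alpha> - \<alpha> * (s powr (\<alpha> - 1) * (s - m))"
    using assms(3) by (simp add: powr_factor[OF assms(3), of \<alpha>] field_simps)
  ultimately show ?thesis using False by simp
qed

text \<open>
  The commutator with a cutoff has order \<open>\<alpha> - 1\<close>: the difference of the symbols at \<open>\<eta>\<close> and \<open>\<xi>\<close> has
  the size of a derivative of the symbol at \<open>\<eta>\<close>, up to a power of the frequency shift \<open>\<xi> - \<eta>\<close> that
  the decay of the transform of the cutoff absorbs. For \<open>\<alpha> < 1\<close> the weight \<open>1 + \<bar>\<eta>\<bar>\<close>, in contrast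
  to \<open>\<bar>\<eta>\<bar>\<close>, also makes the bound finite at \<open>\<eta> = 0\<close>.
\<close>
lemma abs_powr_diff_le:
  fixes \<eta> \<xi> :: real
  assumes \<alpha>: "0 < \<alpha>" "\<alpha> < 2"
  shows "\<bar>\<bar>\<eta>\<bar> powr \<alpha> - \<bar>\<xi>\<bar> powr \<alpha>\<bar> \<le> 4 * (1 + \<bar>\<eta>\<bar>) powr (\<alpha> - 1) * (1 + (\<xi> - \<eta>)\<^sup>2)"
proof -
  define s m t where "s = max \<bar>\<eta>\<bar> \<bar>\<xi>\<bar>" and "m = min \<bar>\<eta>\<bar> \<bar>\<xi>\<bar>" and "t = \<bar>\<xi> - \<eta>\<bar>"
  have sm: "0 \<le> m" "m \<le> s" "s - m \<le> t" "\<bar>\<eta>\<bar> \<le> s" "s \<le> \<bar>\<eta>\<bar> + t" and t0: "0 \<le> t"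
    by (auto simp: s_def m_def t_def)
  have t2: "t \<le> (1 + t\<^sup>2) / 2"
    using sum_squares_bound[of t 1] by simp
  have tt: "t + t\<^sup>2 \<le> 2 * (1 + t\<^sup>2)"
  proof -
    have "x + q \<le> 2 * (1 + q)" if "x \<le> (1 + q) / 2" "0 \<le> q" for x q :: real
      using that by argo
    from this[OF t2 zero_le_power2] show ?thesis .
  qed
  have t3: "1 + 2 * t \<le> 2 * (1 + t\<^sup>2)"
  proof -
    have "1 + 2 * x \<le> 2 * (1 + q)" if "x \<le> (1 + q) / 2" "0 \<le> q" for x q :: real
      using that by argo
    from this[OF t2 zero_le_power2] show ?thesis .
  qed
  have lhs: "\<bar>\<bar>\<eta>\<bar> powr \<alpha> - \<bar>\<xi>\<bar> powr \<alpha>\<bar> = s powr \<alpha> - m powr \<alpha>"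
  proof (cases "\<bar>\<eta>\<bar> \<le> \<bar>\<xi>\<bar>")
    case True
    then show ?thesis using powr_mono2[of \<alpha> "\<bar>\<eta>\<bar>" "\<bar>\<xi>\<bar>"] \<alpha> by (simp add: s_def m_def)
  next
    case False
    then show ?thesis using powr_mono2[of \<alpha> "\<bar>\<xi>\<bar>" "\<bar>\<eta>\<bar>"] \<alpha> by (simp add: s_def m_def)
  qed
  have "s powr \<alpha> - m powr \<alpha> \<le> 4 * (1 + \<bar>\<eta>\<bar>) powr (\<alpha> - 1) * (1 + t\<^sup>2)"
  proof (cases "s = m")
    case False
    then have s: "0 < s" and d: "0 < s - m" using sm by auto
    have up: "s powr \<alpha> - m powr \<alpha> \<le> 2 * s powr (\<alpha> - 1) * (s - m)"
      using sm s \<alpha> by (intro powr_diff_le)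
    show ?thesis
    proof (cases "\<alpha> \<ge> 1")
      case True
      have "s \<le> (1 + \<bar>\<eta>\<bar>) * (1 + t)"
      proof -
        have "0 \<le> \<bar>\<eta>\<bar> * t" using t0 by simp
        moreover have "(1 + \<bar>\<eta>\<bar>) * (1 + t) = 1 + \<bar>\<eta>\<bar> + t + \<bar>\<eta>\<bar> * t" by (simp add: algebra_simps)
        ultimately show ?thesis using sm by linarith
      qed
      then have "s powr (\<alpha> - 1) \<le> ((1 + \<bar>\<eta>\<bar>) * (1 + t)) powr (\<alpha> - 1)"
        using s True by (intro powr_mono2) auto
      also have "\<dots> = (1 + \<bar>\<eta>\<bar>) powr (\<alpha> - 1) * (1 + t) powr (\<alpha> - 1)"
        using t0 by (simp add: powr_mult)
      also have "(1 + t) powr (\<alpha> - 1) \<le> (1 + t) powr 1"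
        using t0 \<alpha> by (intro powr_mono) auto
      finally have "s powr (\<alpha> - 1) \<le> (1 + \<bar>\<eta>\<bar>) powr (\<alpha> - 1) * (1 + t)"
        using t0 by (simp add: mult_left_mono)
      then have "s powr (\<alpha> - 1) * (s - m) \<le> ((1 + \<bar>\<eta>\<bar>) powr (\<alpha> - 1) * (1 + t)) * t"
        using sm d t0 by (intro mult_mono) auto
      also have "\<dots> = (1 + \<bar>\<eta>\<bar>) powr (\<alpha> - 1) * (t + t\<^sup>2)"
        by (simp add: power2_eq_square algebra_simps)
      also have "\<dots> \<le> (1 + \<bar>\<eta>\<bar>) powr (\<alpha> - 1) * (2 * (1 + t\<^sup>2))"
        using tt by (intro mult_left_mono) auto
      finally show ?thesis using up by (simp add: algebra_simps)
    next
      case False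
      \<comment> \<open>Multiplying by \<open>(1 + \<bar>\<eta>\<bar>) powr (1 - \<alpha>) \<le> 1 + s powr (1 - \<alpha>)\<close> splits the bound into a low-frequency part, at most \<open>(s - m) powr \<alpha>\<close>, and a high-frequency part, at most \<open>s - m\<close>.\<close>
      have w: "(1 + \<bar>\<eta>\<bar>) powr (1 - \<alpha>) \<le> 1 + s powr (1 - \<alpha>)"
      proof -
        have "(1 + \<bar>\<eta>\<bar>) powr (1 - \<alpha>) \<le> (1 + s) powr (1 - \<alpha>)"
          using sm False by (intro powr_mono2) auto
        also have "\<dots> = (1 + s) powr (- \<alpha>) * (1 + s)"
          using powr_factor[of "1 + s" "1 - \<alpha>"] s by simp
        also have "\<dots> = (1 + s) powr (- \<alpha>) + (1 + s) powr (- \<alpha>) * s"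
          by (simp add: algebra_simps)
        also have "\<dots> \<le> 1 + s powr (- \<alpha>) * s"
        proof (rule add_mono)
          show "(1 + s) powr (- \<alpha>) \<le> 1"
            using s \<alpha> powr_mono2'[of "- \<alpha>" 1 "1 + s"] by simp
          show "(1 + s) powr (- \<alpha>) * s \<le> s powr (- \<alpha>) * s"
            using s \<alpha> by (intro mult_right_mono powr_mono2') auto
        qed
        also have "s powr (- \<alpha>) * s = s powr (1 - \<alpha>)"
          using powr_factor[of s "1 - \<alpha>"] s by simp
        finally show ?thesis by simp
      qed
      have "s powr (\<alpha> - 1) * (s - m) * (1 + \<bar>\<eta>\<bar>) powr (1 - \<alpha>) \<le> s powr (\<alpha> - 1) * (s - m) * (1 + s powr (1 - \<alpha>))"
        using w d by (intro mult_left_mono) auto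
      also have "\<dots> = s powr (\<alpha> - 1) * (s - m) + (s - m) * (s powr (\<alpha> - 1) * s powr (1 - \<alpha>))"
        by (simp add: algebra_simps)
      also have "s powr (\<alpha> - 1) * s powr (1 - \<alpha>) = 1"
        using s by (simp add: powr_add[symmetric])
      also have "s powr (\<alpha> - 1) * (s - m) \<le> (s - m) powr (\<alpha> - 1) * (s - m)"
        using d sm False by (intro mult_right_mono powr_mono2') auto
      also have "\<dots> = (s - m) powr \<alpha>"
        using powr_factor[OF d, of \<alpha>] by simp
      also have "\<dots> \<le> (1 + t) powr \<alpha>"
        using d sm \<alpha> by (intro powr_mono2) auto
      also have "\<dots> \<le> (1 + t) powr 1"
        using t0 False by (intro powr_mono) auto
      finally have "s powr (\<alpha> - 1) * (s - m) * (1 + \<bar>\<eta>\<bar>) powr (1 - \<alpha>) \<le> 1 + 2 * t"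
        using t0 sm by simp
      also have "\<dots> \<le> 2 * (1 + t\<^sup>2)" by (rule t3)
      finally have "(1 + \<bar>\<eta>\<bar>) powr (\<alpha> - 1) * (s powr (\<alpha> - 1) * (s - m) * (1 + \<bar>\<eta>\<bar>) powr (1 - \<alpha>)) \<le> (1 + \<bar>\<eta>\<bar>) powr (\<alpha> - 1) * (2 * (1 + t\<^sup>2))"
        by (rule mult_left_mono) simp
      moreover have "(1 + \<bar>\<eta>\<bar>) powr (\<alpha> - 1) * (1 + \<bar>\<eta>\<bar>) powr (1 - \<alpha>) = 1"
        by (simp add: powr_add[symmetric] add_pos_nonneg)
      then have "(1 + \<bar>\<eta>\<bar>) powr (\<alpha> - 1) * (s powr (\<alpha> - 1) * (s - m) * (1 + \<bar>\<eta>\<bar>) powr (1 - \<alpha>)) = s powr (\<alpha> - 1) * (s - m)"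
        by (simp only: mult.left_commute[of "(1 + \<bar>\<eta>\<bar>) powr (\<alpha> - 1)"] mult_1_right)
      ultimately show ?thesis using up by linarith
    qed
  qed (simp add: add_nonneg_nonneg)
  moreover have "t\<^sup>2 = (\<xi> - \<eta>)\<^sup>2" by (simp add: t_def)
  ultimately show ?thesis using lhs by simp
qed

text \<open>
  With \<open>s = max \<eta> \<mu>\<close> the symbol satisfies
  \<open>\<bar>\<eta> powr \<alpha> - \<mu> powr \<alpha>\<bar> \<ge> min 1 \<alpha> * s powr (\<alpha> - 1) * \<bar>\<eta> - \<mu>\<bar>\<close>. If \<open>s\<close> is comparable to
  \<open>1 + \<eta>\<close>, or if \<open>\<alpha> \<ge> 1\<close>, this produces the first summand. The second one is for \<open>\<alpha> < 1\<close> and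
  frequencies below \<open>\<mu> / 2\<close>, where the difference is of size \<open>\<mu> powr \<alpha>\<close>, hence at least of size
  \<open>(1 + \<eta>) powr \<alpha>\<close>.
\<close>
lemma inverse_symbol_bound:
  fixes \<eta> \<mu> :: real
  assumes \<alpha>: "0 < \<alpha>" "\<alpha> < 2" and \<mu>: "1 \<le> \<mu>" and \<eta>: "0 \<le> \<eta>" and far: "1 \<le> \<bar>\<eta> - \<mu>\<bar>"
  shows "(1 + \<eta>) powr (\<alpha> - 1) \<le> (4 / min 1 \<alpha>) * (1 / \<bar>\<eta> - \<mu>\<bar> + 1 / (1 + \<eta>)) * \<bar>\<eta> powr \<alpha> - \<mu> powr \<alpha>\<bar>"
proof -
  define s m where "s = max \<eta> \<mu>" and "m = min \<eta> \<mu>"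
  define d where "d = \<bar>\<eta> - \<mu>\<bar>"
  have sm: "0 \<le> m" "m \<le> s" "0 < s" "s - m = d" "\<mu> \<le> s" "\<eta> \<le> s"
    using \<mu> \<eta> by (auto simp: s_def m_def d_def)
  have d: "1 \<le> d" using far by (simp add: d_def)
  have c: "0 < min 1 \<alpha>" using \<alpha> by simp
  have "0 \<le> 1 / d" "0 \<le> 1 / (1 + \<eta>)" using d \<eta> by simp_all
  moreover have "2 * a \<le> 4 * (a + b)" if "0 \<le> a" "0 \<le> b" for a b :: real
    using that by argo
  ultimately have q: "2 * (1 / d) \<le> 4 * (1 / d + 1 / (1 + \<eta>))" by blast
  have "s powr \<alpha> - m powr \<alpha> \<le> \<bar>\<eta> powr \<alpha> - \<mu> powr \<alpha>\<bar>"
    by (auto simp: s_def m_def max_def min_def)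
  then have low: "min 1 \<alpha> * (s powr (\<alpha> - 1) * d) \<le> \<bar>\<eta> powr \<alpha> - \<mu> powr \<alpha>\<bar>"
    using powr_diff_ge[of m s \<alpha>] sm \<alpha> by simp
  have key: "(1 + \<eta>) powr (\<alpha> - 1) \<le> 4 * (1 / d + 1 / (1 + \<eta>)) * (s powr (\<alpha> - 1) * d)"
  proof (cases "\<alpha> \<ge> 1")
    case True
    have "(1 + \<eta>) powr (\<alpha> - 1) \<le> (2 * s) powr (\<alpha> - 1)"
      using True \<eta> \<mu> sm by (intro powr_mono2) auto
    also have "\<dots> = 2 powr (\<alpha> - 1) * s powr (\<alpha> - 1)"
      using sm by (simp add: powr_mult)
    also have "\<dots> \<le> 2 * s powr (\<alpha> - 1)"
      using powr_mono[of "\<alpha> - 1" 1 2] \<alpha> by (intro mult_right_mono) auto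
    finally have "(1 + \<eta>) powr (\<alpha> - 1) \<le> 2 * s powr (\<alpha> - 1)" .
    also have "\<dots> = 2 * (1 / d) * (s powr (\<alpha> - 1) * d)" using d by simp
    also have "\<dots> \<le> 4 * (1 / d + 1 / (1 + \<eta>)) * (s powr (\<alpha> - 1) * d)"
      using q d by (intro mult_right_mono) auto
    finally show ?thesis .
  next
    case False
    show ?thesis
    proof (cases "\<mu> \<le> 2 * \<eta>")
      case True
      have "s powr (1 - \<alpha>) \<le> (2 * (1 + \<eta>)) powr (1 - \<alpha>)"
        using False True \<eta> \<mu> sm by (intro powr_mono2) (auto simp: s_def)
      also have "\<dots> = 2 powr (1 - \<alpha>) * (1 + \<eta>) powr (1 - \<alpha>)"
        by (rule powr_mult)
      also have "\<dots> \<le> 2 * (1 + \<eta>) powr (1 - \<alpha>)"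
        using powr_mono[of "1 - \<alpha>" 1 2] \<alpha> by (intro mult_right_mono) auto
      finally have h: "s powr (1 - \<alpha>) \<le> 2 * (1 + \<eta>) powr (1 - \<alpha>)" .
      have inv: "x powr (\<alpha> - 1) * x powr (1 - \<alpha>) = 1" if "x > 0" for x :: real
        using that by (simp add: powr_add[symmetric])
      have "(1 + \<eta>) powr (\<alpha> - 1) = (1 + \<eta>) powr (\<alpha> - 1) * s powr (\<alpha> - 1) * s powr (1 - \<alpha>)"
        using inv[OF sm(3)] by simp
      also have "\<dots> \<le> (1 + \<eta>) powr (\<alpha> - 1) * s powr (\<alpha> - 1) * (2 * (1 + \<eta>) powr (1 - \<alpha>))"
        using h by (intro mult_left_mono) auto
      also have "\<dots> = 2 * s powr (\<alpha> - 1)"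
        using inv[of "1 + \<eta>"] \<eta> by (simp add: algebra_simps)
      also have "\<dots> = 2 * (1 / d) * (s powr (\<alpha> - 1) * d)" using d by simp
      also have "\<dots> \<le> 4 * (1 / d + 1 / (1 + \<eta>)) * (s powr (\<alpha> - 1) * d)"
        using q d by (intro mult_right_mono) auto
      finally show ?thesis .
    next
      case lt: False
      have s: "s = \<mu>" and dd: "\<mu> \<le> 2 * d" using lt \<eta> by (auto simp: s_def d_def)
      have "((1 + \<eta>) powr \<alpha>) \<le> (2 * \<mu>) powr \<alpha>"
        using lt \<mu> \<eta> \<alpha> by (intro powr_mono2) auto
      also have "\<dots> = 2 powr \<alpha> * \<mu> powr \<alpha>" using \<mu> by (simp add: powr_mult)
      also have "\<dots> \<le> 2 * \<mu> powr \<alpha>"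
        using powr_mono[of \<alpha> 1 2] False by (intro mult_right_mono) auto
      finally have "(1 + \<eta>) powr \<alpha> \<le> 2 * \<mu> powr \<alpha>" .
      also have "\<mu> powr \<alpha> = \<mu> powr (\<alpha> - 1) * \<mu>" using \<mu> by (intro powr_factor) simp
      also have "\<dots> \<le> \<mu> powr (\<alpha> - 1) * (2 * d)" using dd by (intro mult_left_mono) auto
      finally have h: "(1 + \<eta>) powr (\<alpha> - 1) * (1 + \<eta>) \<le> 4 * (s powr (\<alpha> - 1) * d)"
        using powr_factor[of "1 + \<eta>" \<alpha>] \<eta> s by simp
      then have "(1 + \<eta>) powr (\<alpha> - 1) \<le> 4 * (s powr (\<alpha> - 1) * d) / (1 + \<eta>)"
        using \<eta> by (simp add: pos_le_divide_eq)
      also have "\<dots> = 4 * (1 / (1 + \<eta>)) * (s powr (\<alpha> - 1) * d)" by simp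
      also have "\<dots> \<le> 4 * (1 / d + 1 / (1 + \<eta>)) * (s powr (\<alpha> - 1) * d)"
        using d by (intro mult_right_mono) auto
      finally show ?thesis .
    qed
  qed
  have "s powr (\<alpha> - 1) * d \<le> \<bar>\<eta> powr \<alpha> - \<mu> powr \<alpha>\<bar> / min 1 \<alpha>"
    using low c by (simp add: pos_le_divide_eq mult.commute)
  then have "4 * (1 / d + 1 / (1 + \<eta>)) * (s powr (\<alpha> - 1) * d) \<le> 4 * (1 / d + 1 / (1 + \<eta>)) * (\<bar>\<eta> powr \<alpha> - \<mu> powr \<alpha>\<bar> / min 1 \<alpha>)"
    using d \<eta> by (intro mult_left_mono) auto
  with key show ?thesis by (simp add: d_def)
qed

section \<open>The commutator estimate on the Fourier side\<close>

lemma nn_integral_lorentz: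
  "(\<integral>\<^sup>+x. ennreal (1 / (1 + (x - a)\<^sup>2)) \<partial>lborel) = ennreal pi"
proof -
  have int: "integrable lborel (\<lambda>x::real. inverse (1 + x\<^sup>2))"
    and val: "(LINT x|lborel. inverse (1 + x\<^sup>2)) = pi"
    using integrable_inverse_1_plus_square LBINT_inverse_1_plus_square
    by (simp_all add: set_integrable_def interval_lebesgue_integral_def set_lebesgue_integral_def einterval_def)
  have "(\<integral>\<^sup>+x. ennreal (1 / (1 + (x - a)\<^sup>2)) \<partial>lborel) = (\<integral>\<^sup>+x. ennreal (inverse (1 + x\<^sup>2)) \<partial>lborel)"
    by (subst nn_integral_real_affine[where c = 1 and t = a]) (simp_all add: inverse_eq_divide)
  also have "\<dots> = ennreal pi"
    using val by (subst nn_integral_eq_integral[OF int]) (simp_all add: add_nonneg_nonneg)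
  finally show ?thesis .
qed

lemma integrable_lorentz: "integrable lborel (\<lambda>x::real. 1 / (1 + (x - a)\<^sup>2))"
  using nn_integral_lorentz[of a]
  by (intro integrableI_nonneg) (auto intro!: AE_I2 simp: add_nonneg_nonneg)

text \<open>
  Young's inequality for the convolution with the kernel \<open>1 / (1 + x\<^sup>2)\<close> of mass \<open>\<pi>\<close>: by the
  Cauchy--Schwarz inequality with weight the kernel, and Fubini.
\<close>
lemma lorentz_convolution_L2:
  fixes g :: "real \<Rightarrow> real"
  assumes [measurable]: "g \<in> borel_measurable borel" and g0: "\<And>x. 0 \<le> g x"
  shows "(\<integral>\<^sup>+\<eta>. (\<integral>\<^sup>+\<xi>. ennreal (g \<xi> / (1 + (\<xi> - \<eta>)\<^sup>2)) \<partial>lborel)\<^sup>2 \<partial>lborel)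
    \<le> ennreal (pi\<^sup>2) * (\<integral>\<^sup>+\<xi>. ennreal ((g \<xi>)\<^sup>2) \<partial>lborel)"
proof -
  let ?q = "\<lambda>\<xi> \<eta>. ennreal (1 / (1 + (\<xi> - \<eta>)\<^sup>2))"
  let ?r = "\<lambda>\<xi> \<eta>. ennreal (sqrt (1 / (1 + (\<xi> - \<eta>)\<^sup>2)))"
  have pos: "0 < 1 + (\<xi> - \<eta>)\<^sup>2" for \<xi> \<eta> :: real by (simp add: add_pos_nonneg)
  have rq: "?r \<xi> \<eta> * ?r \<xi> \<eta> = ?q \<xi> \<eta>" for \<xi> \<eta>
    using less_imp_le[OF pos[of \<xi> \<eta>]] by (simp add: ennreal_mult[symmetric])
  have "(\<integral>\<^sup>+\<xi>. ennreal (g \<xi> / (1 + (\<xi> - \<eta>)\<^sup>2)) \<partial>lborel)\<^sup>2 \<le> ennreal pi * (\<integral>\<^sup>+\<xi>. ennreal ((g \<xi>)\<^sup>2) * ?q \<xi> \<eta> \<partial>lborel)" for \<eta>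
  proof -
    have "(\<integral>\<^sup>+\<xi>. ennreal (g \<xi> / (1 + (\<xi> - \<eta>)\<^sup>2)) \<partial>lborel) = (\<integral>\<^sup>+\<xi>. ?r \<xi> \<eta> * (ennreal (g \<xi>) * ?r \<xi> \<eta>) \<partial>lborel)"
    proof (rule nn_integral_cong)
      fix \<xi>
      have "ennreal (g \<xi> / (1 + (\<xi> - \<eta>)\<^sup>2)) = ennreal (g \<xi>) * ?q \<xi> \<eta>"
        using g0[of \<xi>] less_imp_le[OF pos[of \<xi> \<eta>]] by (simp add: ennreal_mult[symmetric])
      then show "ennreal (g \<xi> / (1 + (\<xi> - \<eta>)\<^sup>2)) = ?r \<xi> \<eta> * (ennreal (g \<xi>) * ?r \<xi> \<eta>)"
        unfolding rq[symmetric] by (simp only: mult_ac)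
    qed
    then have "(\<integral>\<^sup>+\<xi>. ennreal (g \<xi> / (1 + (\<xi> - \<eta>)\<^sup>2)) \<partial>lborel)\<^sup>2
        \<le> (\<integral>\<^sup>+\<xi>. (?r \<xi> \<eta>)\<^sup>2 \<partial>lborel) * (\<integral>\<^sup>+\<xi>. (ennreal (g \<xi>) * ?r \<xi> \<eta>)\<^sup>2 \<partial>lborel)"
      using Cauchy_Schwarz_nn_integral[of "\<lambda>\<xi>. ?r \<xi> \<eta>" lborel "\<lambda>\<xi>. ennreal (g \<xi>) * ?r \<xi> \<eta>"] by simp
    moreover have "(\<integral>\<^sup>+\<xi>. (?r \<xi> \<eta>)\<^sup>2 \<partial>lborel) = ennreal pi"
      by (simp only: power2_eq_square[where 'a=ennreal] rq nn_integral_lorentz)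
    moreover have "(\<integral>\<^sup>+\<xi>. (ennreal (g \<xi>) * ?r \<xi> \<eta>)\<^sup>2 \<partial>lborel) = (\<integral>\<^sup>+\<xi>. ennreal ((g \<xi>)\<^sup>2) * ?q \<xi> \<eta> \<partial>lborel)"
    proof (rule nn_integral_cong)
      fix \<xi>
      have "(ennreal (g \<xi>) * ?r \<xi> \<eta>)\<^sup>2 = (ennreal (g \<xi>))\<^sup>2 * (?r \<xi> \<eta> * ?r \<xi> \<eta>)"
        by (simp only: power2_eq_square mult_ac)
      then show "(ennreal (g \<xi>) * ?r \<xi> \<eta>)\<^sup>2 = ennreal ((g \<xi>)\<^sup>2) * ?q \<xi> \<eta>"
        by (simp only: rq ennreal_power[OF g0])
    qed
    ultimately show ?thesis by simp
  qed
  then have "(\<integral>\<^sup>+\<eta>. (\<integral>\<^sup>+\<xi>. ennreal (g \<xi> / (1 + (\<xi> - \<eta>)\<^sup>2)) \<partial>lborel)\<^sup>2 \<partial>lborel)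
     \<le> (\<integral>\<^sup>+\<eta>. ennreal pi * (\<integral>\<^sup>+\<xi>. ennreal ((g \<xi>)\<^sup>2) * ?q \<xi> \<eta> \<partial>lborel) \<partial>lborel)"
    by (rule nn_integral_mono)
  also have "\<dots> = ennreal pi * (\<integral>\<^sup>+\<eta>. (\<integral>\<^sup>+\<xi>. ennreal ((g \<xi>)\<^sup>2) * ?q \<xi> \<eta> \<partial>lborel) \<partial>lborel)"
    by (rule nn_integral_cmult) measurable
  also have "(\<integral>\<^sup>+\<eta>. (\<integral>\<^sup>+\<xi>. ennreal ((g \<xi>)\<^sup>2) * ?q \<xi> \<eta> \<partial>lborel) \<partial>lborel) = (\<integral>\<^sup>+\<xi>. (\<integral>\<^sup>+\<eta>. ennreal ((g \<xi>)\<^sup>2) * ?q \<xi> \<eta> \<partial>lborel) \<partial>lborel)"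
    by (rule lborel_pair.Fubini') measurable
  also have "\<dots> = (\<integral>\<^sup>+\<xi>. ennreal ((g \<xi>)\<^sup>2) * ennreal pi \<partial>lborel)"
  proof (rule nn_integral_cong)
    fix \<xi>
    have "(\<integral>\<^sup>+\<eta>. ?q \<xi> \<eta> \<partial>lborel) = ennreal pi"
      using nn_integral_lorentz[of \<xi>] by (simp add: power2_commute[of _ \<xi>])
    then show "(\<integral>\<^sup>+\<eta>. ennreal ((g \<xi>)\<^sup>2) * ?q \<xi> \<eta> \<partial>lborel) = ennreal ((g \<xi>)\<^sup>2) * ennreal pi"
      by (subst nn_integral_cmult) simp_all
  qed
  also have "\<dots> = (\<integral>\<^sup>+\<xi>. ennreal ((g \<xi>)\<^sup>2) \<partial>lborel) * ennreal pi"
    by (rule nn_integral_multc) measurable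
  also have "ennreal pi * ((\<integral>\<^sup>+\<xi>. ennreal ((g \<xi>)\<^sup>2) \<partial>lborel) * ennreal pi) = (ennreal pi * ennreal pi) * (\<integral>\<^sup>+\<xi>. ennreal ((g \<xi>)\<^sup>2) \<partial>lborel)"
    by (simp only: mult_ac)
  also have "ennreal pi * ennreal pi = ennreal (pi\<^sup>2)"
    by (simp add: ennreal_mult[symmetric] power2_eq_square)
  finally show ?thesis .
qed

definition cutoff :: "real \<Rightarrow> real \<Rightarrow> complex" where
  "cutoff r = bump r 0 1 0"

lemma bump_modulated: "bump r \<eta> 1 0 x = cis (- (x * \<eta>)) * cutoff r x"
  by (simp add: bump_def cutoff_def)

lemma fourier_bump_modulated: "fourier (bump r \<eta> 1 0) \<zeta> = fourier (cutoff r) (\<eta> + \<zeta>)"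
proof -
  have "cis (- (x * \<zeta>)) * (cis (- (x * \<eta>)) * c) = cis (- (x * (\<eta> + \<zeta>))) * c" for x c
    unfolding mult.assoc[symmetric] cis_mult by (simp add: algebra_simps)
  then show ?thesis
    unfolding fourier_def bump_modulated by (simp only:)
qed

text \<open>
  Parseval's formula for \<open>f\<close> and the modulated cutoff expresses the transform of \<open>cutoff r * f\<close> at
  \<open>\<eta>\<close> as a convolution, and the equation tested with the modulated cutoff expresses \<open>lam\<close> times it as
  the convolution with the symbol \<open>\<bar>\<xi>\<bar> powr \<alpha>\<close> inserted. Subtracting \<open>\<bar>\<eta>\<bar> powr \<alpha>\<close> times the first
  identity leaves the difference of the symbols, to which \<open>abs_powr_diff_le\<close> applies.
\<close>
lemma cutoff_fourier_estimate:
  fixes f :: "real \<Rightarrow> complex"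
  assumes \<alpha>: "0 < \<alpha>" "\<alpha> < 2" and r: "0 < r" and f: "integrable lborel f"
    and A: "\<And>\<zeta>. cmod (fourier (cutoff r) \<zeta>) \<le> A / (1 + \<zeta>\<^sup>2)\<^sup>2"
    and eq: "(LINT \<xi>|lborel. complex_of_real (\<bar>\<xi>\<bar> powr \<alpha>) * fourier f \<xi> * (fourier (bump r \<eta> 1 0) (- \<xi>) / complex_of_real (2 * pi)))
      = lam * (LINT x|lborel. f x * bump r \<eta> 1 0 x)"
  shows "\<bar>\<bar>\<eta>\<bar> powr \<alpha> - lam\<bar> * cmod (fourier (\<lambda>x. cutoff r x * f x) \<eta>)
    \<le> A * (1 + \<bar>\<eta>\<bar>) powr (\<alpha> - 1) * (LINT \<xi>|lborel. cmod (fourier f \<xi>) / (1 + (\<xi> - \<eta>)\<^sup>2))"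
proof -
  have [measurable]: "f \<in> borel_measurable borel"
    using borel_measurable_integrable[OF f] by simp
  have [measurable]: "cutoff r \<in> borel_measurable borel"
    unfolding cutoff_def by (intro borel_measurable_continuous_onI continuous_on_bump)
  define G where "G = fourier f"
  define W where "W = fourier (\<lambda>x. cutoff r x * f x) \<eta>"
  define k where "k \<xi> = fourier (cutoff r) (\<eta> - \<xi>)" for \<xi>
  define q where "q \<xi> = 1 / (1 + (\<xi> - \<eta>)\<^sup>2)" for \<xi>
  have [measurable]: "G \<in> borel_measurable borel" "k \<in> borel_measurable borel" "q \<in> borel_measurable borel"
    unfolding G_def k_def q_def by measurable
  have pos: "0 < 1 + (\<xi> - \<eta>)\<^sup>2" for \<xi> :: real by (simp add: add_pos_nonneg)
  have q: "0 \<le> q \<xi>" "q \<xi> \<le> 1" "(1 + (\<xi> - \<eta>)\<^sup>2) * q \<xi> = 1" for \<xi>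
    using pos[of \<xi>] by (auto simp: q_def)
  have A0: "0 \<le> A" using order_trans[OF norm_ge_zero A[of 0]] by simp
  have kq: "cmod (k \<xi>) \<le> A * (q \<xi>)\<^sup>2" for \<xi>
    using A[of "\<eta> - \<xi>"] by (simp add: k_def q_def power_divide power2_commute[of \<eta>])
  have kq': "cmod (k \<xi>) \<le> A * q \<xi>" for \<xi>
  proof -
    have "q \<xi> * q \<xi> \<le> q \<xi>" by (rule mult_left_le[OF q(2) q(1)])
    then have "A * (q \<xi>)\<^sup>2 \<le> A * q \<xi>"
      unfolding power2_eq_square by (rule mult_left_mono[OF _ A0])
    then show ?thesis using kq[of \<xi>] by linarith
  qed
  have "integrable lborel (\<lambda>\<xi>. (LINT x|lborel. cmod (f x)) * q \<xi>)"
    unfolding q_def by (intro integrable_mult_right integrable_lorentz)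
  then have Gq: "integrable lborel (\<lambda>\<xi>. cmod (G \<xi>) * q \<xi>)"
  proof (rule Bochner_Integration.integrable_bound)
    have "cmod (G \<xi>) * q \<xi> \<le> (LINT x|lborel. cmod (f x)) * q \<xi>" for \<xi>
      unfolding G_def by (rule mult_right_mono[OF norm_fourier_le q(1)])
    then show "AE \<xi> in lborel. norm (cmod (G \<xi>) * q \<xi>) \<le> norm ((LINT x|lborel. cmod (f x)) * q \<xi>)"
      using q(1) by (intro AE_I2) (auto simp: abs_mult intro: order_trans[OF _ abs_ge_self])
  qed measurable
  have AGq: "integrable lborel (\<lambda>\<xi>. c * (cmod (G \<xi>) * q \<xi>))" for c
    using Gq by (rule integrable_mult_right)
  have Gk: "integrable lborel (\<lambda>\<xi>. k \<xi> * G \<xi>)"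
  proof (rule Bochner_Integration.integrable_bound[OF AGq[of A]])
    have "cmod (k \<xi> * G \<xi>) \<le> A * (cmod (G \<xi>) * q \<xi>)" for \<xi>
      using mult_right_mono[OF kq'[of \<xi>] norm_ge_zero[of "G \<xi>"]] by (simp add: norm_mult mult_ac)
    then show "AE \<xi> in lborel. cmod (k \<xi> * G \<xi>) \<le> norm (A * (cmod (G \<xi>) * q \<xi>))"
      by (intro AE_I2) (auto intro: order_trans[OF _ abs_ge_self])
  qed measurable
  let ?d = "\<lambda>\<xi>. complex_of_real (\<bar>\<eta>\<bar> powr \<alpha> - \<bar>\<xi>\<bar> powr \<alpha>) * (k \<xi> * G \<xi>)"
  let ?c = "4 * (1 + \<bar>\<eta>\<bar>) powr (\<alpha> - 1) * A"
  have dbound: "cmod (?d \<xi>) \<le> ?c * (cmod (G \<xi>) * q \<xi>)" for \<xi>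
  proof -
    have "cmod (?d \<xi>) = \<bar>\<bar>\<eta>\<bar> powr \<alpha> - \<bar>\<xi>\<bar> powr \<alpha>\<bar> * (cmod (k \<xi>) * cmod (G \<xi>))"
      by (simp only: norm_mult norm_of_real real_norm_def)
    also have "\<dots> \<le> (4 * (1 + \<bar>\<eta>\<bar>) powr (\<alpha> - 1) * (1 + (\<xi> - \<eta>)\<^sup>2)) * ((A * (q \<xi>)\<^sup>2) * cmod (G \<xi>))"
      using abs_powr_diff_le[OF \<alpha>, of \<eta> \<xi>] kq[of \<xi>]
      by (intro mult_mono mult_right_mono) (auto simp: A0)
    also have "\<dots> = ?c * (cmod (G \<xi>) * (((1 + (\<xi> - \<eta>)\<^sup>2) * q \<xi>) * q \<xi>))"
      by (simp only: power2_eq_square[of "q \<xi>"] mult_ac)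
    finally show ?thesis by (simp only: q(3) mult_1)
  qed
  have d: "integrable lborel ?d"
    by (rule Bochner_Integration.integrable_bound[OF AGq[of ?c]])
       (measurable, intro AE_I2 order_trans[OF dbound], simp)
  have W: "W = (LINT x|lborel. bump r \<eta> 1 0 x * f x)"
    by (simp add: W_def fourier_def bump_modulated mult.assoc)
  have fW: "(LINT x|lborel. f x * bump r \<eta> 1 0 x) = W"
    unfolding W by (intro Bochner_Integration.integral_cong refl mult.commute)
  have kk: "fourier (bump r \<eta> 1 0) (- \<xi>) = k \<xi>" for \<xi>
    by (simp add: fourier_bump_modulated k_def)
  obtain B where B: "\<And>x. cmod (bump r \<eta> 1 0 x) \<le> B"
    using bounded_bump[OF r] by blast
  have P: "(LINT \<xi>|lborel. k \<xi> * G \<xi>) = 2 * pi * W"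
  proof -
    have "(LINT \<xi>|lborel. fourier (bump r \<eta> 1 0) (- \<xi>) * fourier f \<xi>) = 2 * pi * (LINT x|lborel. bump r \<eta> 1 0 x * f x)"
    proof (rule parseval[OF integrable_bump[OF r] continuous_on_bump _ f])
      show "cmod (bump r \<eta> 1 0 x) \<le> B" for x by (rule B)
      show "integrable lborel (\<lambda>\<xi>. fourier (bump r \<eta> 1 0) (- \<xi>) * fourier f \<xi>)"
        using Gk by (simp only: kk G_def)
    qed
    then show ?thesis by (simp only: kk G_def W)
  qed
  have "(LINT \<xi>|lborel. complex_of_real (\<bar>\<xi>\<bar> powr \<alpha>) * (k \<xi> * G \<xi>)) = 2 * pi * (lam * W)"
  proof -
    have "(LINT \<xi>|lborel. complex_of_real (\<bar>\<xi>\<bar> powr \<alpha>) * (k \<xi> * G \<xi>))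
        = (LINT \<xi>|lborel. (2 * pi) * (complex_of_real (\<bar>\<xi>\<bar> powr \<alpha>) * fourier f \<xi> * (fourier (bump r \<eta> 1 0) (- \<xi>) / complex_of_real (2 * pi))))"
      unfolding kk G_def[symmetric] by (intro Bochner_Integration.integral_cong refl) (simp add: field_simps)
    also have "\<dots> = 2 * pi * (lam * W)"
      by (subst integral_mult_right_zero) (simp only: eq fW)
    finally show ?thesis .
  qed
  moreover have "(LINT \<xi>|lborel. complex_of_real (\<bar>\<xi>\<bar> powr \<alpha>) * (k \<xi> * G \<xi>))
    = (LINT \<xi>|lborel. complex_of_real (\<bar>\<eta>\<bar> powr \<alpha>) * (k \<xi> * G \<xi>) - ?d \<xi>)"
    by (intro Bochner_Integration.integral_cong refl) (simp add: algebra_simps)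
  moreover have "\<dots> = complex_of_real (\<bar>\<eta>\<bar> powr \<alpha>) * (LINT \<xi>|lborel. k \<xi> * G \<xi>) - (LINT \<xi>|lborel. ?d \<xi>)"
    by (subst Bochner_Integration.integral_diff[OF integrable_mult_right[OF Gk] d]) (simp only: integral_mult_right_zero)
  ultimately have "(LINT \<xi>|lborel. ?d \<xi>) = 2 * pi * ((complex_of_real (\<bar>\<eta>\<bar> powr \<alpha>) - lam) * W)"
    unfolding P by (simp add: algebra_simps)
  then have "cmod (LINT \<xi>|lborel. ?d \<xi>) = 2 * pi * (\<bar>\<bar>\<eta>\<bar> powr \<alpha> - lam\<bar> * cmod W)"
    by (simp only: norm_mult of_real_diff[symmetric] norm_of_real) simp
  moreover have "cmod (LINT \<xi>|lborel. ?d \<xi>) \<le> (LINT \<xi>|lborel. ?c * (cmod (G \<xi>) * q \<xi>))"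
    by (rule Bochner_Integration.integral_norm_bound_integral[OF d AGq dbound])
  moreover have "(LINT \<xi>|lborel. ?c * (cmod (G \<xi>) * q \<xi>)) = ?c * (LINT \<xi>|lborel. cmod (G \<xi>) * q \<xi>)"
    by (rule integral_mult_right_zero)
  ultimately have "2 * pi * (\<bar>\<bar>\<eta>\<bar> powr \<alpha> - lam\<bar> * cmod W) \<le> ?c * (LINT \<xi>|lborel. cmod (G \<xi>) * q \<xi>)" (is "?L \<le> _ * ?I")
    by (simp only:)
  moreover define R where "R = A * (1 + \<bar>\<eta>\<bar>) powr (\<alpha> - 1) * ?I"
  moreover have "?c * ?I = 4 * R"
    by (simp only: R_def mult_ac)
  moreover have "4 * R \<le> 2 * pi * R"
  proof (rule mult_right_mono)
    show "0 \<le> R"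
      unfolding R_def using A0 q(1) by (intro mult_nonneg_nonneg integral_nonneg_AE AE_I2) auto
  qed (use pi_gt3 in simp)
  ultimately have "2 * pi * (\<bar>\<bar>\<eta>\<bar> powr \<alpha> - lam\<bar> * cmod W) \<le> 2 * pi * R" by linarith
  then have "\<bar>\<bar>\<eta>\<bar> powr \<alpha> - lam\<bar> * cmod W \<le> R" by simp
  then show ?thesis by (simp add: R_def W_def G_def q_def)
qed

section \<open>The bound for a localised solution\<close>

lemma mult_le_scaled_squares:
  fixes x H s :: real
  assumes "0 < s"
  shows "x * H \<le> s * x\<^sup>2 / 2 + H\<^sup>2 / (2 * s)"
proof -
  have "0 \<le> (s * x - H)\<^sup>2 / (2 * s)" using assms by simp
  also have "\<dots> = s * x\<^sup>2 / 2 + H\<^sup>2 / (2 * s) - x * H"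
    using assms by (simp add: field_simps power2_eq_square)
  finally show ?thesis by simp
qed

text \<open>
  The parameter \<open>s\<close> is later the \<open>L\<^sup>2\<close> norm of \<open>f\<close>; for this choice the
  right-hand side is \<open>3 / 2\<close> times that norm, as the Cauchy--Schwarz inequality on \<open>(-1, 1)\<close> predicts
  up to the constant.
\<close>
lemma integrable_of_square_integrable:
  fixes f :: "real \<Rightarrow> complex"
  assumes [measurable]: "f \<in> borel_measurable borel" and supp: "\<And>x. x \<notin> {-1<..<1} \<Longrightarrow> f x = 0"
    and f2: "integrable lborel (\<lambda>x. (cmod (f x))\<^sup>2)" and s: "0 < s"
  shows "integrable lborel f"
    and "(LINT x|lborel. cmod (f x)) \<le> s + (LINT x|lborel. (cmod (f x))\<^sup>2) / (2 * s)"
proof -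
  let ?b = "\<lambda>x. s / 2 * indicator {-1<..<1} x + (cmod (f x))\<^sup>2 / (2 * s)"
  have b: "integrable lborel ?b"
    using f2 by (intro Bochner_Integration.integrable_add integrable_mult_right integrable_divide integrable_real_indicator) auto
  have le: "cmod (f x) \<le> ?b x" for x
    using mult_le_scaled_squares[OF s, of 1 "cmod (f x)"] supp[of x] by (cases "x \<in> {-1<..<1}") auto
  show f: "integrable lborel f"
    by (rule Bochner_Integration.integrable_bound[OF b]) (measurable, intro AE_I2 order_trans[OF le], simp)
  have "(LINT x|lborel. cmod (f x)) \<le> (LINT x|lborel. ?b x)"
    by (rule integral_mono[OF integrable_norm[OF f] b le])
  also have "\<dots> = s + (LINT x|lborel. (cmod (f x))\<^sup>2) / (2 * s)"
  proof -
    have "integrable lborel (\<lambda>x. s / 2 * indicator {-1<..<1::real} x)"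
      by (intro integrable_mult_right integrable_real_indicator) auto
    then show ?thesis using f2 by (subst Bochner_Integration.integral_add) auto
  qed
  finally show "(LINT x|lborel. cmod (f x)) \<le> s + (LINT x|lborel. (cmod (f x))\<^sup>2) / (2 * s)" .
qed

text \<open>
  A positive function of fixed integral \<open>3 \<pi>\<close> that dominates, up to a factor \<open>2\<close>, the squares of \<open>1 / \<bar>\<bar>\<eta>\<bar> - \<mu>\<bar>\<close> (away
  from the resonances \<open>\<plusminus> \<mu>\<close>) and of \<open>1 / (1 + \<bar>\<eta>\<bar>)\<close>. The three summands have a common form so that
  \<open>nn_integral_lorentz\<close> applies to each.
\<close>
definition resonance_weight :: "real \<Rightarrow> real \<Rightarrow> real" where
  "resonance_weight \<mu> \<eta> = 1 / (1 + (\<eta> - \<mu>)\<^sup>2) + 1 / (1 + (\<eta> - (- \<mu>))\<^sup>2) + 1 / (1 + (\<eta> - 0)\<^sup>2)"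

lemma resonance_weight_nonneg: "0 \<le> resonance_weight \<mu> \<eta>"
  unfolding resonance_weight_def by (intro add_nonneg_nonneg) (auto simp: add_nonneg_nonneg)

lemma resonance_weight_measurable [measurable]: "resonance_weight \<mu> \<in> borel_measurable borel"
  unfolding resonance_weight_def by measurable

lemma nn_integral_resonance_weight:
  "(\<integral>\<^sup>+\<eta>. ennreal (resonance_weight \<mu> \<eta>) \<partial>lborel) = ennreal (3 * pi)"
proof -
  have "0 \<le> 1 / (1 + (\<eta> - a)\<^sup>2)" for \<eta> a :: real by (simp add: add_nonneg_nonneg)
  then have "ennreal (resonance_weight \<mu> \<eta>) = ennreal (1 / (1 + (\<eta> - \<mu>)\<^sup>2)) + ennreal (1 / (1 + (\<eta> - (- \<mu>))\<^sup>2)) + ennreal (1 / (1 + (\<eta> - 0)\<^sup>2))" for \<eta>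
    unfolding resonance_weight_def by (simp only: ennreal_plus add_nonneg_nonneg)
  then have "(\<integral>\<^sup>+\<eta>. ennreal (resonance_weight \<mu> \<eta>) \<partial>lborel) = ennreal pi + ennreal pi + ennreal pi"
    by (simp only: nn_integral_add nn_integral_lorentz borel_measurable_add, subst nn_integral_add) (simp_all add: nn_integral_add nn_integral_lorentz[of 0, simplified] nn_integral_lorentz[of "- \<mu>", simplified] nn_integral_lorentz)
  then show ?thesis by (simp add: ennreal_plus[symmetric] del: ennreal_plus)
qed

lemma resonance_weight_ge:
  "1 / (1 + (\<bar>\<eta>\<bar> - \<mu>)\<^sup>2) \<le> resonance_weight \<mu> \<eta>"
  "1 / (1 + (\<bar>\<eta>\<bar> - \<mu>)\<^sup>2) + 1 / (1 + \<eta>\<^sup>2) \<le> resonance_weight \<mu> \<eta>"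
proof -
  have p: "0 \<le> 1 / (1 + (\<eta> - a)\<^sup>2)" for a :: real by (simp add: add_nonneg_nonneg)
  have "1 / (1 + (\<bar>\<eta>\<bar> - \<mu>)\<^sup>2) \<le> 1 / (1 + (\<eta> - \<mu>)\<^sup>2) + 1 / (1 + (\<eta> - (- \<mu>))\<^sup>2)"
  proof (cases "0 \<le> \<eta>")
    case True
    then show ?thesis using p[of "- \<mu>"] by simp
  next
    case False
    then have "(\<bar>\<eta>\<bar> - \<mu>)\<^sup>2 = (\<eta> - (- \<mu>))\<^sup>2" by (simp add: power2_eq_square algebra_simps)
    then show ?thesis using p[of \<mu>] by simp
  qed
  then show "1 / (1 + (\<bar>\<eta>\<bar> - \<mu>)\<^sup>2) + 1 / (1 + \<eta>\<^sup>2) \<le> resonance_weight \<mu> \<eta>"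
    by (simp add: resonance_weight_def)
  moreover have "0 \<le> 1 / (1 + \<eta>\<^sup>2)" using p[of 0] by (simp only: diff_0_right)
  ultimately show "1 / (1 + (\<bar>\<eta>\<bar> - \<mu>)\<^sup>2) \<le> resonance_weight \<mu> \<eta>" by linarith
qed

lemma far_weight_bound:
  fixes H s :: real
  assumes "0 < s" "1 \<le> \<bar>\<bar>\<eta>\<bar> - \<mu>\<bar>"
  shows "(1 / \<bar>\<bar>\<eta>\<bar> - \<mu>\<bar> + 1 / (1 + \<bar>\<eta>\<bar>)) * H \<le> s * resonance_weight \<mu> \<eta> + H\<^sup>2 / s"
proof -
  define d where "d = \<bar>\<bar>\<eta>\<bar> - \<mu>\<bar>"
  have d: "1 \<le> d" and d2: "(\<bar>\<eta>\<bar> - \<mu>)\<^sup>2 = d\<^sup>2" using assms by (auto simp: d_def)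
  have "1 \<le> d\<^sup>2" using d by (simp add: one_le_power)
  then have "1 / (2 * d\<^sup>2) \<le> 1 / (1 + d\<^sup>2)"
    by (intro divide_left_mono mult_pos_pos add_pos_nonneg) auto
  moreover have "(1 / d)\<^sup>2 = 2 * (1 / (2 * d\<^sup>2))" by (simp add: power_divide)
  ultimately have 1: "(1 / d)\<^sup>2 \<le> 2 * (1 / (1 + d\<^sup>2))" by linarith
  have "1 + \<eta>\<^sup>2 \<le> (1 + \<bar>\<eta>\<bar>)\<^sup>2" by (simp add: power2_eq_square algebra_simps)
  then have 2: "(1 / (1 + \<bar>\<eta>\<bar>))\<^sup>2 \<le> 1 / (1 + \<eta>\<^sup>2)"
    unfolding power_divide by (simp add: frac_le add_pos_nonneg)
  have n: "0 \<le> 1 / (1 + \<eta>\<^sup>2)" by (simp add: add_nonneg_nonneg)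
  have "(1 / d)\<^sup>2 / 2 + (1 / (1 + \<bar>\<eta>\<bar>))\<^sup>2 / 2 \<le> 1 / (1 + d\<^sup>2) + 1 / (1 + \<eta>\<^sup>2)"
    using 1 2 n by linarith
  also have "\<dots> \<le> resonance_weight \<mu> \<eta>"
    using resonance_weight_ge(2)[of \<eta> \<mu>] by (simp only: d2)
  finally have "s * ((1 / d)\<^sup>2 / 2 + (1 / (1 + \<bar>\<eta>\<bar>))\<^sup>2 / 2) \<le> s * resonance_weight \<mu> \<eta>"
    using assms(1) by (intro mult_left_mono) auto
  moreover have "(1 / d + 1 / (1 + \<bar>\<eta>\<bar>)) * H \<le> s * ((1 / d)\<^sup>2 / 2 + (1 / (1 + \<bar>\<eta>\<bar>))\<^sup>2 / 2) + H\<^sup>2 / s"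
  proof -
    have "H\<^sup>2 / (2 * s) + H\<^sup>2 / (2 * s) = H\<^sup>2 / s" using assms(1) by (simp add: field_simps)
    then show ?thesis
      using mult_le_scaled_squares[OF assms(1), of "1 / d" H] mult_le_scaled_squares[OF assms(1), of "1 / (1 + \<bar>\<eta>\<bar>)" H]
      by (simp only: distrib_right distrib_left times_divide_eq_right)
  qed
  ultimately show ?thesis by (simp add: d_def)
qed

text \<open>
  On the Fourier side, \<open>far_weight_bound\<close> handles the frequencies at distance at least \<open>1\<close> from the
  resonances. On the remaining ones the weight is at least \<open>1 / 2\<close>, so that the trivial bound of the
  transform by the \<open>L\<^sup>1\<close> norm can be multiplied by it. In both cases the bound is integrable in \<open>\<eta>\<close>,
  uniformly in \<open>lam\<close>.
\<close>
lemma cutoff_sup_bound: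
  assumes \<alpha>: "0 < \<alpha>" "\<alpha> < 2" and r: "0 < r"
  shows "\<exists>C>0. \<forall>lam f. 1 < lam \<longrightarrow> f \<in> borel_measurable borel \<longrightarrow> (\<forall>x. x \<notin> {-1<..<1} \<longrightarrow> f x = 0) \<longrightarrow>
    integrable lborel (\<lambda>x. (cmod (f x))\<^sup>2) \<longrightarrow>
    (\<forall>\<eta>. (LINT \<xi>|lborel. complex_of_real (\<bar>\<xi>\<bar> powr \<alpha>) * fourier f \<xi> * (fourier (bump r \<eta> 1 0) (- \<xi>) / complex_of_real (2 * pi)))
      = complex_of_real lam * (LINT x|lborel. f x * bump r \<eta> 1 0 x)) \<longrightarrow>
    (AE x in lborel. cmod (cutoff r x * f x) \<le> C * sqrt (LINT x|lborel. (cmod (f x))\<^sup>2))"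
proof -
  obtain A where A0: "0 < A" and A: "\<And>\<zeta>. cmod (fourier (cutoff r) \<zeta>) \<le> A / (1 + \<zeta>\<^sup>2)\<^sup>2"
    using fourier_bump_decay[OF r, of 0 1 0] unfolding cutoff_def by blast
  obtain B' where B': "\<And>x. cmod (cutoff r x) \<le> B'"
    using bounded_bump[OF r, of 0 1 0] unfolding cutoff_def by blast
  define B where "B = max B' 0"
  have B: "0 \<le> B" "\<And>x. cmod (cutoff r x) \<le> B" using B' by (auto simp: B_def le_max_iff_disj)
  \<comment> \<open>The first summand of \<open>c\<close> serves the frequencies away from the resonances, the second one those near them.\<close>
  define c where "c = A * (4 / min 1 \<alpha>) + 3 * B"
  have cA: "0 < A * (4 / min 1 \<alpha>)" using A0 \<alpha> by simp
  have c: "0 < c" using cA B(1) by (simp add: c_def)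
  define C where "C = c * (3 * pi + 2 * pi ^ 3) / pi"
  have C: "0 < C" using c pi_gt_zero by (simp add: C_def add_pos_pos)
  show ?thesis
  proof (intro exI[of _ C] conjI allI impI C)
    fix lam :: real and f :: "real \<Rightarrow> complex"
    assume lam: "1 < lam" and [measurable]: "f \<in> borel_measurable borel"
      and supp: "\<forall>x. x \<notin> {-1<..<1} \<longrightarrow> f x = 0"
      and f2: "integrable lborel (\<lambda>x. (cmod (f x))\<^sup>2)"
      and eq: "\<forall>\<eta>. (LINT \<xi>|lborel. complex_of_real (\<bar>\<xi>\<bar> powr \<alpha>) * fourier f \<xi> * (fourier (bump r \<eta> 1 0) (- \<xi>) / complex_of_real (2 * pi)))
        = complex_of_real lam * (LINT x|lborel. f x * bump r \<eta> 1 0 x)"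
    have chi[measurable]: "cutoff r \<in> borel_measurable borel"
      unfolding cutoff_def by (intro borel_measurable_continuous_onI continuous_on_bump)
    let ?N = "LINT x|lborel. (cmod (f x))\<^sup>2"
    define s where "s = sqrt ?N"
    have N0: "0 \<le> ?N" by (intro integral_nonneg_AE AE_I2) simp
    show "AE x in lborel. cmod (cutoff r x * f x) \<le> C * sqrt ?N"
      \<comment> \<open>The estimates below divide by the norm \<open>s\<close> of \<open>f\<close>.\<close>
    proof (cases "?N = 0")
      case True
      then have "AE x in lborel. (cmod (f x))\<^sup>2 = 0"
        using integral_nonneg_eq_0_iff_AE[OF f2] by simp
      then show ?thesis unfolding True by eventually_elim simp
    next
      case False
      then have "0 < ?N" using N0 by linarith
      then have s: "0 < s" and s2: "s\<^sup>2 = ?N" by (simp_all add: s_def)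
      have f: "integrable lborel f"
        using integrable_of_square_integrable(1)[OF _ _ f2 s] supp by simp
      have "(LINT x|lborel. cmod (f x)) \<le> s + s\<^sup>2 / (2 * s)"
        using integrable_of_square_integrable(2)[OF _ _ f2 s] supp s2 by simp
      then have f1: "(LINT x|lborel. cmod (f x)) \<le> 3 / 2 * s"
        using s by (simp add: power2_eq_square)
      define w where "w x = cutoff r x * f x" for x
      have [measurable]: "w \<in> borel_measurable borel" unfolding w_def by measurable
      have wB: "cmod (w x) \<le> B * cmod (f x)" for x
        unfolding w_def norm_mult by (rule mult_right_mono[OF B(2) norm_ge_zero])
      have Bf: "integrable lborel (\<lambda>x. B * cmod (f x))" using f by (simp add: integrable_norm)
      have w: "integrable lborel w"
        by (rule Bochner_Integration.integrable_bound[OF Bf]) (measurable, intro AE_I2 order_trans[OF wB], simp)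
      have W1: "cmod (fourier w \<eta>) \<le> 3 / 2 * B * s" for \<eta>
      proof -
        have "cmod (fourier w \<eta>) \<le> (LINT x|lborel. cmod (w x))" by (rule norm_fourier_le)
        also have "\<dots> \<le> (LINT x|lborel. B * cmod (f x))"
          by (rule integral_mono[OF integrable_norm[OF w] Bf wB])
        also have "\<dots> \<le> B * (3 / 2 * s)"
          using mult_left_mono[OF f1 B(1)] by simp
        finally show ?thesis by (simp add: mult_ac)
      qed
      define H where "H \<eta> = (LINT \<xi>|lborel. cmod (fourier f \<xi>) / (1 + (\<xi> - \<eta>)\<^sup>2))" for \<eta>
      define \<mu> where "\<mu> = lam powr (1 / \<alpha>)"
      have \<mu>1: "1 \<le> \<mu>" using lam \<alpha> by (simp add: \<mu>_def ge_one_powr_ge_zero)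
      have \<mu>: "\<mu> powr \<alpha> = lam" using lam \<alpha> by (simp add: \<mu>_def powr_powr)
      have H0: "0 \<le> H \<eta>" for \<eta>
        unfolding H_def by (intro integral_nonneg_AE AE_I2) (simp add: add_nonneg_nonneg)
      have Hm[measurable]: "H \<in> borel_measurable borel"
        unfolding H_def by measurable
      have pt: "cmod (fourier w \<eta>) \<le> c * (s * resonance_weight \<mu> \<eta> + (H \<eta>)\<^sup>2 / s)" for \<eta>
      proof -
        define E where "E = s * resonance_weight \<mu> \<eta> + (H \<eta>)\<^sup>2 / s"
        have E0: "0 \<le> E" using s resonance_weight_nonneg by (simp add: E_def)
        show ?thesis
        proof (cases "1 \<le> \<bar>\<bar>\<eta>\<bar> - \<mu>\<bar>")
          case True
          let ?\<Delta> = "\<bar>\<bar>\<eta>\<bar> powr \<alpha> - lam\<bar>" and ?a = "1 / \<bar>\<bar>\<eta>\<bar> - \<mu>\<bar> + 1 / (1 + \<bar>\<eta>\<bar>)"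
          have sym: "(1 + \<bar>\<eta>\<bar>) powr (\<alpha> - 1) \<le> (4 / min 1 \<alpha>) * ?a * ?\<Delta>"
            using inverse_symbol_bound[OF \<alpha> \<mu>1 abs_ge_zero True] by (simp only: \<mu>)
          have "0 < (1 + \<bar>\<eta>\<bar>) powr (\<alpha> - 1)" by (simp add: add_pos_nonneg)
          then have \<Delta>: "0 < ?\<Delta>" using sym by (cases "?\<Delta> = 0") auto
          have "?\<Delta> * cmod (fourier w \<eta>) \<le> A * (1 + \<bar>\<eta>\<bar>) powr (\<alpha> - 1) * H \<eta>"
            unfolding w_def H_def using eq by (intro cutoff_fourier_estimate[OF \<alpha> r f A]) blast
          also have "\<dots> \<le> A * ((4 / min 1 \<alpha>) * ?a * ?\<Delta>) * H \<eta>"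
            using sym A0 H0 by (intro mult_right_mono mult_left_mono) auto
          also have "\<dots> = ?\<Delta> * (A * (4 / min 1 \<alpha>) * (?a * H \<eta>))" by (simp only: mult_ac)
          finally have "cmod (fourier w \<eta>) \<le> A * (4 / min 1 \<alpha>) * (?a * H \<eta>)"
            using \<Delta> by (simp only: mult_le_cancel_left_pos)
          also have "\<dots> \<le> A * (4 / min 1 \<alpha>) * E"
            unfolding E_def using far_weight_bound[OF s True] cA by (intro mult_left_mono) auto
          also have "\<dots> \<le> c * E"
            using B(1) E0 by (intro mult_right_mono) (auto simp: c_def)
          finally show ?thesis by (simp only: E_def)
        next
          case False
          then have "\<bar>\<bar>\<eta>\<bar> - \<mu>\<bar>\<^sup>2 \<le> 1" by (intro power_le_one) auto
          then have "1 / 2 \<le> 1 / (1 + (\<bar>\<eta>\<bar> - \<mu>)\<^sup>2)"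
            by (intro divide_left_mono) (auto simp: add_pos_nonneg)
          also have "\<dots> \<le> resonance_weight \<mu> \<eta>" by (rule resonance_weight_ge(1))
          finally have "s * (1 / 2) \<le> s * resonance_weight \<mu> \<eta>" using s by (intro mult_left_mono) auto
          moreover have "0 \<le> (H \<eta>)\<^sup>2 / s" using s by simp
          ultimately have sE: "s / 2 \<le> E" unfolding E_def by linarith
          have "cmod (fourier w \<eta>) \<le> 3 * B * (s / 2)" using W1[of \<eta>] by simp
          also have "\<dots> \<le> 3 * B * E" using sE B(1) by (intro mult_left_mono) auto
          also have "\<dots> \<le> c * E" using cA E0 by (intro mult_right_mono) (auto simp: c_def)
          finally show ?thesis by (simp only: E_def)
        qed
      qed
      have HL2: "(\<integral>\<^sup>+\<eta>. ennreal ((H \<eta>)\<^sup>2) \<partial>lborel) \<le> ennreal (2 * pi ^ 3 * s\<^sup>2)"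
      proof -
        have G2: "(\<integral>\<^sup>+\<xi>. ennreal ((cmod (fourier f \<xi>))\<^sup>2) \<partial>lborel) \<le> ennreal (2 * pi * s\<^sup>2)"
        proof -
          have "(\<integral>\<^sup>+x. ennreal ((cmod (f x))\<^sup>2) \<partial>lborel) = ennreal (s\<^sup>2)"
            using nn_integral_eq_integral[OF f2] s2 by simp
          then show ?thesis using plancherel_le[OF f] by (simp add: ennreal_mult)
        qed
        have "ennreal ((H \<eta>)\<^sup>2) \<le> (\<integral>\<^sup>+\<xi>. ennreal (cmod (fourier f \<xi>) / (1 + (\<xi> - \<eta>)\<^sup>2)) \<partial>lborel)\<^sup>2" for \<eta>
        proof -
          have "ennreal (H \<eta>) \<le> (\<integral>\<^sup>+\<xi>. ennreal (cmod (fourier f \<xi>) / (1 + (\<xi> - \<eta>)\<^sup>2)) \<partial>lborel)"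
            using norm_integral_le_nn_integral[of lborel "\<lambda>\<xi>. cmod (fourier f \<xi>) / (1 + (\<xi> - \<eta>)\<^sup>2)"] H0[of \<eta>]
            by (simp add: H_def add_nonneg_nonneg)
          then show ?thesis
            unfolding ennreal_power[OF H0, symmetric] by (rule power_mono) simp
        qed
        then have "(\<integral>\<^sup>+\<eta>. ennreal ((H \<eta>)\<^sup>2) \<partial>lborel) \<le> (\<integral>\<^sup>+\<eta>. (\<integral>\<^sup>+\<xi>. ennreal (cmod (fourier f \<xi>) / (1 + (\<xi> - \<eta>)\<^sup>2)) \<partial>lborel)\<^sup>2 \<partial>lborel)"
          by (rule nn_integral_mono)
        also have "\<dots> \<le> ennreal (pi\<^sup>2) * (\<integral>\<^sup>+\<xi>. ennreal ((cmod (fourier f \<xi>))\<^sup>2) \<partial>lborel)"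
          by (rule lorentz_convolution_L2) auto
        also have "\<dots> \<le> ennreal (pi\<^sup>2) * ennreal (2 * pi * s\<^sup>2)"
          using G2 by (rule mult_left_mono) simp
        also have "\<dots> = ennreal (2 * pi ^ 3 * s\<^sup>2)"
          by (simp add: ennreal_mult[symmetric] power2_eq_square power3_eq_cube mult_ac)
        finally show ?thesis .
      qed
      have L1: "(\<integral>\<^sup>+\<eta>. ennreal (cmod (fourier w \<eta>)) \<partial>lborel) \<le> ennreal (pi * C * s)"
      proof -
        have split: "ennreal (c * (s * resonance_weight \<mu> \<eta> + (H \<eta>)\<^sup>2 / s))
          = ennreal (c * s) * ennreal (resonance_weight \<mu> \<eta>) + ennreal (c / s) * ennreal ((H \<eta>)\<^sup>2)" for \<eta>
        proof -
          have "c * (s * resonance_weight \<mu> \<eta> + (H \<eta>)\<^sup>2 / s) = c * s * resonance_weight \<mu> \<eta> + c / s * (H \<eta>)\<^sup>2"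
            by (simp add: algebra_simps)
          then show ?thesis
            using c s resonance_weight_nonneg[of \<mu> \<eta>] by (simp only:) (simp add: ennreal_mult[symmetric] ennreal_plus[symmetric] del: ennreal_plus)
        qed
        have "(\<integral>\<^sup>+\<eta>. ennreal (cmod (fourier w \<eta>)) \<partial>lborel) \<le> (\<integral>\<^sup>+\<eta>. ennreal (c * (s * resonance_weight \<mu> \<eta> + (H \<eta>)\<^sup>2 / s)) \<partial>lborel)"
          by (intro nn_integral_mono ennreal_leI pt)
        also have "\<dots> = ennreal (c * s) * ennreal (3 * pi) + ennreal (c / s) * (\<integral>\<^sup>+\<eta>. ennreal ((H \<eta>)\<^sup>2) \<partial>lborel)"
          unfolding split by (subst nn_integral_add) (simp_all add: nn_integral_cmult nn_integral_resonance_weight)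
        also have "\<dots> \<le> ennreal (c * s) * ennreal (3 * pi) + ennreal (c / s) * ennreal (2 * pi ^ 3 * s\<^sup>2)"
          using HL2 by (intro add_left_mono mult_left_mono) auto
        also have "\<dots> = ennreal (c * s * (3 * pi) + c / s * (2 * pi ^ 3 * s\<^sup>2))"
          using c s by (simp add: ennreal_mult[symmetric] ennreal_plus[symmetric] del: ennreal_plus)
        also have "c * s * (3 * pi) + c / s * (2 * pi ^ 3 * s\<^sup>2) = pi * C * s"
          using s by (simp add: C_def power2_eq_square field_simps)
        finally show ?thesis .
      qed
      have Wint: "integrable lborel (fourier w)"
        using L1 by (intro integrableI_bounded) (auto intro: le_less_trans)
      have "(LINT \<eta>|lborel. cmod (fourier w \<eta>)) \<le> pi * C * s"
        using L1 C s nn_integral_eq_integral[OF integrable_norm[OF Wint]] by (simp add: ennreal_le_iff)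
      then have M: "(LINT \<eta>|lborel. cmod (fourier w \<eta>)) / pi \<le> C * s"
        by (simp add: pos_divide_le_eq mult_ac)
      from AE_cmod_le_fourier[OF w Wint] show ?thesis
        by eventually_elim (use M in \<open>simp add: w_def s_def\<close>)
    qed
  qed
qed

section \<open>Eigenfunctions\<close>

lemma borel_representative:
  fixes e :: "real \<Rightarrow> complex"
  assumes e: "e \<in> borel_measurable lebesgue" and supp: "AE x in lebesgue. x \<notin> {-1<..<1} \<longrightarrow> e x = 0"
  obtains f where "f \<in> borel_measurable borel" "\<And>x. x \<notin> {-1<..<1} \<Longrightarrow> f x = 0"
    "AE x in lebesgue. e x = f x"
proof -
  have re: "(\<lambda>x. Re (e x)) \<in> borel_measurable lebesgue" and im: "(\<lambda>x. Im (e x)) \<in> borel_measurable lebesgue"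
    using e by measurable
  obtain a where [measurable]: "a \<in> borel_measurable lborel" and a: "AE x in lborel. Re (e x) = a x"
    using completion_ex_borel_measurable_real[OF re] by blast
  obtain b where [measurable]: "b \<in> borel_measurable lborel" and b: "AE x in lborel. Im (e x) = b x"
    using completion_ex_borel_measurable_real[OF im] by blast
  define f where "f x = indicator {-1<..<1} x *\<^sub>R Complex (a x) (b x)" for x
  have "f \<in> borel_measurable borel"
    unfolding f_def Complex_eq by measurable
  moreover have "f x = 0" if "x \<notin> {-1<..<1}" for x
    using that by (simp add: f_def)
  moreover have "AE x in lebesgue. e x = f x"
    using supp AE_completion[OF a] AE_completion[OF b]
    by eventually_elim (auto simp: f_def indicator_def complex_eq_iff)
  ultimately show ?thesis by (rule that)
qed

lemma integral_lebesgue_eq_lborel: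
  fixes u v :: "real \<Rightarrow> 'b::{banach, second_countable_topology}"
  assumes "u \<in> borel_measurable lebesgue" "v \<in> borel_measurable borel" "AE x in lebesgue. u x = v x"
  shows "(LINT x|lebesgue. u x) = (LINT x|lborel. v x)"
proof -
  have v: "v \<in> borel_measurable lborel" using assms(2) by simp
  have "(LINT x|lebesgue. u x) = (LINT x|lebesgue. v x)"
    by (rule integral_cong_AE[OF assms(1) measurable_completion[OF v] assms(3)])
  then show ?thesis using integral_completion[OF v] by simp
qed

text \<open>
  The truncations to \<open>[-R, R]\<close> with \<open>R \<ge> 1\<close> all agree with \<open>f\<close> almost everywhere, so their transforms
  form a constant family.
\<close>
lemma plancherel_transform_eq_fourier:
  fixes e f g :: "real \<Rightarrow> complex"
  assumes g: "has_fourier_transform e g" and f: "f \<in> borel_measurable borel"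
    and supp: "\<And>x. x \<notin> {-1<..<1} \<Longrightarrow> f x = 0" and ef: "AE x in lebesgue. e x = f x"
  shows "AE \<xi> in lebesgue. g \<xi> = fourier f \<xi>"
proof -
  have e: "e \<in> borel_measurable lebesgue" and gm: "g \<in> borel_measurable lebesgue"
    using g by (auto simp: has_fourier_transform_def L2_fun_def)
  note [measurable] = f
  have trunc: "(LINT x:{-R..R}|lebesgue. exp (- \<i> * complex_of_real (x * \<xi>)) * e x) = fourier f \<xi>"
    if "1 \<le> R" for R \<xi>
  proof -
    have "(LINT x:{-R..R}|lebesgue. exp (- \<i> * complex_of_real (x * \<xi>)) * e x)
      = (LINT x|lborel. indicator {-R..R} x *\<^sub>R (cis (- (x * \<xi>)) * f x))"
      unfolding set_lebesgue_integral_def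
    proof (rule integral_lebesgue_eq_lborel)
      have "(\<lambda>x. indicator {-R..R} x *\<^sub>R exp (- \<i> * complex_of_real (x * \<xi>))) \<in> borel_measurable borel"
        by measurable
      then have "(\<lambda>x. indicator {-R..R} x *\<^sub>R exp (- \<i> * complex_of_real (x * \<xi>))) \<in> borel_measurable lebesgue"
        by (simp add: measurable_completion)
      from borel_measurable_times[OF this e]
      show "(\<lambda>x. indicator {-R..R} x *\<^sub>R (exp (- \<i> * complex_of_real (x * \<xi>)) * e x)) \<in> borel_measurable lebesgue"
        by simp
      show "AE x in lebesgue. indicator {-R..R} x *\<^sub>R (exp (- \<i> * complex_of_real (x * \<xi>)) * e x)
          = indicator {-R..R} x *\<^sub>R (cis (- (x * \<xi>)) * f x)"
        using ef by eventually_elim (simp add: cis_conv_exp)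
    qed measurable
    also have "\<dots> = fourier f \<xi>"
      unfolding fourier_def using supp that
      by (intro Bochner_Integration.integral_cong refl) (auto simp: indicator_def)
    finally show ?thesis .
  qed
  let ?I = "\<integral>\<^sup>+ \<xi>. ennreal ((cmod (g \<xi> - fourier f \<xi>))\<^sup>2) \<partial>lebesgue"
  have "((\<lambda>R. ?I) \<longlongrightarrow> 0) (at_top :: real filter)"
  proof (rule Lim_transform_eventually)
    show "((\<lambda>R. \<integral>\<^sup>+ \<xi>. ennreal ((cmod (g \<xi> -
          (LINT x:{-R..R}|lebesgue. exp (- \<i> * complex_of_real (x * \<xi>)) * e x)))\<^sup>2) \<partial>lebesgue) \<longlongrightarrow> 0) at_top"
      using g by (simp add: has_fourier_transform_def)
    show "\<forall>\<^sub>F R in at_top. (\<integral>\<^sup>+ \<xi>. ennreal ((cmod (g \<xi> -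
          (LINT x:{-R..R}|lebesgue. exp (- \<i> * complex_of_real (x * \<xi>)) * e x)))\<^sup>2) \<partial>lebesgue) = ?I"
      using eventually_ge_at_top[of "1::real"] by eventually_elim (simp only: trunc)
  qed
  then have "?I = 0"
    by (simp add: tendsto_const_iff)
  moreover have "(\<lambda>\<xi>. ennreal ((cmod (g \<xi> - fourier f \<xi>))\<^sup>2)) \<in> borel_measurable lebesgue"
  proof -
    have "fourier f \<in> borel_measurable lborel" by measurable
    from borel_measurable_diff[OF gm measurable_completion[OF this]]
    show ?thesis by measurable
  qed
  ultimately have "AE \<xi> in lebesgue. ennreal ((cmod (g \<xi> - fourier f \<xi>))\<^sup>2) = 0"
    by (simp only: nn_integral_0_iff_AE)
  then show ?thesis by eventually_elim simp
qed

lemma inv_fourier_eq: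
  assumes "\<phi> \<in> borel_measurable borel"
  shows "inv_fourier \<phi> \<xi> = fourier \<phi> (- \<xi>) / complex_of_real (2 * pi)"
proof -
  have [measurable]: "\<phi> \<in> borel_measurable borel" by fact
  have "(\<lambda>x. exp (\<i> * complex_of_real (x * \<xi>)) * \<phi> x) \<in> borel_measurable lborel" by measurable
  from integral_completion[OF this] show ?thesis
    by (simp add: inv_fourier_def fourier_def cis_conv_exp)
qed

lemma eigenfunction_weak_equation:
  fixes e f :: "real \<Rightarrow> complex"
  assumes e: "dirichlet_eigenfunction \<alpha> {-1<..<1} lam e" and f[measurable]: "f \<in> borel_measurable borel"
    and supp: "\<And>x. x \<notin> {-1<..<1} \<Longrightarrow> f x = 0" and ef: "AE x in lebesgue. e x = f x"
    and \<phi>: "\<phi> \<in> test_functions {-1<..<1}" "\<phi> \<in> borel_measurable borel"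
  shows "(LINT \<xi>|lborel. complex_of_real (\<bar>\<xi>\<bar> powr \<alpha>) * fourier f \<xi> * (fourier \<phi> (- \<xi>) / complex_of_real (2 * pi)))
    = complex_of_real lam * (LINT x|lborel. f x * \<phi> x)"
proof -
  note [measurable] = \<phi>(2)
  obtain g where g: "has_fourier_transform e g"
    and eq: "(LINT \<xi>|lebesgue. complex_of_real (\<bar>\<xi>\<bar> powr \<alpha>) * g \<xi> * inv_fourier \<phi> \<xi>)
      = (LINT x|lebesgue. complex_of_real lam * e x * \<phi> x)"
    using e \<phi>(1) by (auto simp: dirichlet_eigenfunction_def frac_laplacian_eq_on_def)
  have em: "e \<in> borel_measurable lebesgue" and gm: "g \<in> borel_measurable lebesgue"
    using g by (auto simp: has_fourier_transform_def L2_fun_def)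
  have leb: "u \<in> borel_measurable lebesgue" if "u \<in> borel_measurable borel" for u :: "real \<Rightarrow> complex"
    using that by (intro measurable_completion) simp
  let ?k = "\<lambda>\<xi>. fourier \<phi> (- \<xi>) / complex_of_real (2 * pi)"
  have "(LINT \<xi>|lborel. complex_of_real (\<bar>\<xi>\<bar> powr \<alpha>) * fourier f \<xi> * ?k \<xi>)
    = (LINT \<xi>|lebesgue. complex_of_real (\<bar>\<xi>\<bar> powr \<alpha>) * g \<xi> * inv_fourier \<phi> \<xi>)"
    unfolding inv_fourier_eq[OF \<phi>(2)]
  proof (rule integral_lebesgue_eq_lborel[symmetric])
    show "(\<lambda>\<xi>. complex_of_real (\<bar>\<xi>\<bar> powr \<alpha>) * g \<xi> * ?k \<xi>) \<in> borel_measurable lebesgue"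
      by (intro borel_measurable_times gm leb) measurable
    show "AE \<xi> in lebesgue. complex_of_real (\<bar>\<xi>\<bar> powr \<alpha>) * g \<xi> * ?k \<xi> = complex_of_real (\<bar>\<xi>\<bar> powr \<alpha>) * fourier f \<xi> * ?k \<xi>"
    proof -
      have "AE \<xi> in lebesgue. g \<xi> = fourier f \<xi>"
        by (rule plancherel_transform_eq_fourier[OF g f _ ef]) (rule supp)
      then show ?thesis by eventually_elim simp
    qed
  qed measurable
  also have "\<dots> = (LINT x|lborel. complex_of_real lam * (f x * \<phi> x))"
    unfolding eq
  proof (rule integral_lebesgue_eq_lborel)
    show "(\<lambda>x. complex_of_real lam * e x * \<phi> x) \<in> borel_measurable lebesgue"
      by (intro borel_measurable_times em leb) measurable
    show "AE x in lebesgue. complex_of_real lam * e x * \<phi> x = complex_of_real lam * (f x * \<phi> x)"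
      using ef by eventually_elim simp
  qed measurable
  finally show ?thesis by simp
qed

lemma compact_in_unit_interval:
  fixes K :: "real set"
  assumes "compact K" "K \<subseteq> {-1<..<1}"
  obtains \<rho> where "0 \<le> \<rho>" "\<rho> < 1" "\<And>x. x \<in> K \<Longrightarrow> \<bar>x\<bar> \<le> \<rho>"
proof (cases "K = {}")
  case True
  then show ?thesis using that[of 0] by simp
next
  case False
  have "continuous_on K (\<lambda>x. \<bar>x\<bar>)" by (intro continuous_intros)
  then obtain z where "z \<in> K" "\<And>x. x \<in> K \<Longrightarrow> \<bar>x\<bar> \<le> \<bar>z\<bar>"
    using continuous_attains_sup[OF assms(1) False] by blast
  then show ?thesis using that[of "\<bar>z\<bar>"] assms(2) by force
qed

lemma cutoff_lower_bound:
  assumes "\<bar>x\<bar> \<le> \<rho>" "\<rho> < r"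
  shows "exp (- 1 / (r\<^sup>2 - \<rho>\<^sup>2)) \<le> cmod (cutoff r x)"
proof -
  have \<rho>: "0 \<le> \<rho>" using assms(1) by linarith
  have x: "x\<^sup>2 \<le> \<rho>\<^sup>2" using assms(1) power_mono[of "\<bar>x\<bar>" \<rho> 2] by simp
  have p: "\<rho>\<^sup>2 < r\<^sup>2" using assms(2) \<rho> by (intro power_strict_mono) auto
  have "1 / (r\<^sup>2 - x\<^sup>2) \<le> 1 / (r\<^sup>2 - \<rho>\<^sup>2)"
    using x p by (intro divide_left_mono mult_pos_pos) auto
  moreover have "cmod (cutoff r x) = exp (- 1 / (r\<^sup>2 - x\<^sup>2))"
    using x p by (simp add: cutoff_def bump_def flat_exp_def norm_mult)
  ultimately show ?thesis by simp
qed

text \<open>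
  The radius \<open>r\<close> of the cutoff lies strictly between \<open>1\<close> and the largest \<open>\<bar>x\<bar>\<close> on \<open>K\<close>, so that
  the modulated cutoffs are admissible test functions and the cutoff is bounded below on \<open>K\<close>; the
  cutoff can then be divided out.
\<close>
lemma eigenfunction_interior_bound:
  fixes \<alpha> :: real and K :: "real set"
  assumes \<alpha>: "0 < \<alpha>" "\<alpha> < 2" and K: "compact K" "K \<subseteq> {-1<..<1}"
  shows "\<exists>C>0. \<forall>lam e. 1 < lam \<longrightarrow> dirichlet_eigenfunction \<alpha> {-1<..<1} lam e \<longrightarrow>
    Linf_norm_on K e \<le> ennreal (C * L2_norm_on_line e)"
proof -
  obtain \<rho> where \<rho>: "0 \<le> \<rho>" "\<rho> < 1" "\<And>x. x \<in> K \<Longrightarrow> \<bar>x\<bar> \<le> \<rho>"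
    using compact_in_unit_interval[OF K] by blast
  define r where "r = (1 + \<rho>) / 2"
  have r: "0 < r" "r < 1" "\<rho> < r" using \<rho> by (auto simp: r_def)
  define m where "m = exp (- 1 / (r\<^sup>2 - \<rho>\<^sup>2))"
  have m0: "0 < m" by (simp add: m_def)
  have m: "m \<le> cmod (cutoff r x)" if "x \<in> K" for x
    unfolding m_def by (rule cutoff_lower_bound[OF \<rho>(3)[OF that] r(3)])
  obtain C where C: "0 < C" and bound: "\<And>lam f. 1 < lam \<Longrightarrow> f \<in> borel_measurable borel \<Longrightarrow>
      (\<forall>x. x \<notin> {-1<..<1} \<longrightarrow> f x = 0) \<Longrightarrow> integrable lborel (\<lambda>x. (cmod (f x))\<^sup>2) \<Longrightarrow>
      (\<forall>\<eta>. (LINT \<xi>|lborel. complex_of_real (\<bar>\<xi>\<bar> powr \<alpha>) * fourier f \<xi> * (fourier (bump r \<eta> 1 0) (- \<xi>) / complex_of_real (2 * pi)))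
        = complex_of_real lam * (LINT x|lborel. f x * bump r \<eta> 1 0 x)) \<Longrightarrow>
      AE x in lborel. cmod (cutoff r x * f x) \<le> C * sqrt (LINT x|lborel. (cmod (f x))\<^sup>2)"
    using cutoff_sup_bound[OF \<alpha> r(1)] by blast
  show ?thesis
  proof (intro exI[of _ "C / m"] conjI allI impI)
    show "0 < C / m" using C m0 by simp
    fix lam :: real and e :: "real \<Rightarrow> complex"
    assume lam: "1 < lam" and e: "dirichlet_eigenfunction \<alpha> {-1<..<1} lam e"
    have L2: "L2_fun e" and e0: "AE x in lebesgue. x \<notin> {-1<..<1} \<longrightarrow> e x = 0"
      using e by (auto simp: dirichlet_eigenfunction_def frac_laplacian_eq_on_def has_fourier_transform_def)
    have em: "e \<in> borel_measurable lebesgue" and e2: "integrable lebesgue (\<lambda>x. (cmod (e x))\<^sup>2)"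
      using L2 by (auto simp: L2_fun_def)
    obtain f where f[measurable]: "f \<in> borel_measurable borel"
      and supp: "\<And>x. x \<notin> {-1<..<1} \<Longrightarrow> f x = 0" and ef: "AE x in lebesgue. e x = f x"
      using borel_representative[OF em e0] by blast
    have sq: "(\<lambda>x. (cmod (f x))\<^sup>2) \<in> borel_measurable lborel" by measurable
    have em2: "(\<lambda>x. (cmod (e x))\<^sup>2) \<in> borel_measurable lebesgue" using em by measurable
    have ef2: "AE x in lebesgue. (cmod (e x))\<^sup>2 = (cmod (f x))\<^sup>2"
      using ef by eventually_elim simp
    have "integrable lebesgue (\<lambda>x. (cmod (f x))\<^sup>2)"
      using e2 integrable_cong_AE[OF em2 measurable_completion[OF sq] ef2] by simp
    then have f2: "integrable lborel (\<lambda>x. (cmod (f x))\<^sup>2)"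
      using integrable_completion[OF sq] by simp
    have norm: "L2_norm_on_line e = sqrt (LINT x|lborel. (cmod (f x))\<^sup>2)"
      unfolding L2_norm_on_line_def using integral_lebesgue_eq_lborel[OF em2 _ ef2] sq by simp
    have "AE x in lborel. cmod (cutoff r x * f x) \<le> C * L2_norm_on_line e"
      unfolding norm
    proof (rule bound[OF lam f _ f2])
      show "\<forall>\<eta>. (LINT \<xi>|lborel. complex_of_real (\<bar>\<xi>\<bar> powr \<alpha>) * fourier f \<xi> * (fourier (bump r \<eta> 1 0) (- \<xi>) / complex_of_real (2 * pi)))
        = complex_of_real lam * (LINT x|lborel. f x * bump r \<eta> 1 0 x)"
      proof
        fix \<eta>
        have "bump r \<eta> 1 0 \<in> borel_measurable borel"
          by (intro borel_measurable_continuous_onI continuous_on_bump)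
        then show "(LINT \<xi>|lborel. complex_of_real (\<bar>\<xi>\<bar> powr \<alpha>) * fourier f \<xi> * (fourier (bump r \<eta> 1 0) (- \<xi>) / complex_of_real (2 * pi)))
            = complex_of_real lam * (LINT x|lborel. f x * bump r \<eta> 1 0 x)"
          by (intro eigenfunction_weak_equation[OF e f _ ef] supp bump_test_function r(1,2))
      qed
    qed (use supp in blast)
    from AE_completion[OF this] ef
    have "AE x in lebesgue. x \<in> K \<longrightarrow> ennreal (cmod (e x)) \<le> ennreal (C / m * L2_norm_on_line e)"
    proof eventually_elim
      case (elim x)
      show ?case
      proof
        assume "x \<in> K"
        have "m * cmod (e x) \<le> cmod (cutoff r x) * cmod (e x)"
          using m[OF \<open>x \<in> K\<close>] by (intro mult_right_mono) auto
        also have "\<dots> \<le> C * L2_norm_on_line e"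
          using elim by (simp add: norm_mult)
        finally show "ennreal (cmod (e x)) \<le> ennreal (C / m * L2_norm_on_line e)"
          using m0 by (intro ennreal_leI) (simp add: field_simps)
      qed
    qed
    moreover have "K \<in> sets lebesgue" using K(1) by (simp add: compact_imp_closed)
    ultimately have "AE x in lebesgue_on K. ennreal (cmod (e x)) \<le> ennreal (C / m * L2_norm_on_line e)"
      by (subst AE_restrict_space_iff) auto
    moreover have "(\<lambda>x. ennreal (cmod (e x))) \<in> borel_measurable (lebesgue_on K)"
      using em by (intro measurable_restrict_space1) measurable
    ultimately show "Linf_norm_on K e \<le> ennreal (C / m * L2_norm_on_line e)"
      unfolding Linf_norm_on_def by (intro esssup_I)
  qed
qed

theorem theorem8:
  fixes \<alpha> :: real and K :: "real set"
  assumes "0 < \<alpha>" and "\<alpha> < 2" and "compact K" and "K \<subseteq> {-1<..<1}"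
  shows "\<exists>C::real. C > 0 \<and>
    (\<forall>(lam::real) (e :: real \<Rightarrow> complex).
       lam > 1 \<longrightarrow> dirichlet_eigenfunction \<alpha> {-1<..<1} lam e \<longrightarrow>
         (1/4 \<le> \<alpha> \<and> \<alpha> < 2 \<longrightarrow>
            Linf_norm_on K e \<le> ennreal (C * L2_norm_on_line e)) \<and>
         (1/8 \<le> \<alpha> \<and> \<alpha> < 1/4 \<longrightarrow>
            Linf_norm_on K e \<le>
              ennreal (C * lam powr (1 / (2 * \<alpha>) - 2) * L2_norm_on_line e)) \<and>
         (0 < \<alpha> \<and> \<alpha> < 1/8 \<longrightarrow>
            Linf_norm_on K e \<le>
              ennreal (C * lam powr (1 / (3 * \<alpha>) - 2/3) * L2_norm_on_line e)))"
proof -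
  obtain C where C: "0 < C" and bound: "\<And>lam e. 1 < lam \<Longrightarrow>
      dirichlet_eigenfunction \<alpha> {-1<..<1} lam e \<Longrightarrow> Linf_norm_on K e \<le> ennreal (C * L2_norm_on_line e)"
    using eigenfunction_interior_bound[OF assms] by blast
  have weaken: "Linf_norm_on K e \<le> ennreal (C * lam powr p * L2_norm_on_line e)"
    if lam: "1 < lam" and e: "dirichlet_eigenfunction \<alpha> {-1<..<1} lam e" and p: "0 \<le> p" for lam p e
  proof -
    have "1 \<le> lam powr p" using lam p by (simp add: ge_one_powr_ge_zero)
    then have "C * 1 * L2_norm_on_line e \<le> C * lam powr p * L2_norm_on_line e"
      using C by (intro mult_right_mono mult_left_mono) (auto simp: L2_norm_on_line_def)
    then show ?thesis
      using order_trans[OF bound[OF lam e] ennreal_leI] by simp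
  qed
  have "0 \<le> 1 / (2 * \<alpha>) - 2" if "\<alpha> < 1/4"
    using that assms(1) by (simp add: field_simps)
  moreover have "0 \<le> 1 / (3 * \<alpha>) - 2/3" if "\<alpha> < 1/8"
    using that assms(1) by (simp add: field_simps)
  ultimately show ?thesis
    using C bound weaken by (intro exI[of _ C]) blast
qed

end
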